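(* Let $p$ be an odd prime and let $f=\exp(x^p/p+x)$. Then for every integer $s\ge 0$, $$\left[\left(\mathcal{D}\frac{1}{x}\right)^s f\right]_0=\frac{(-1)^s}{s!}\,\Gamma_p^{(s)}(0),$$ where $\Gamma_p^{(s)}(0)$ is the $s$-th derivative at $0$ of the $p$-adic Gamma function.
   Context: $p$ is an odd prime and $\mathbb{C}_p$ is the completion of the algebraic closure of $\mathbb{Q}_p$. The power series $f=\exp(x^p/p+x)=\sum_{i\ge 0}B_i x^i$ (Dwork exponential) has coefficients $B_i\in\mathbb{Q}$. $\mathcal{D}=\sum_{i=0}^\infty \partial_x^i$ is a formal differential operator of infinite order. The operator $\mathcal{D}\frac1x$ means: multiply by $1/x$, then apply $\mathcal{D}$; $\left(\mathcal{D}\frac1x\right)^s$ is its $s$-fold iterate. On a monomial $x^k$ ($k\ge 0$) the result is a formal Laurent series, with only finitely many positive powers of $x$ but possibly infinitely many negative powers. $[\,\cdot\,]_0$ denotes the coefficient of $x^0$ of a formal Laurent series. For a power series $g=\sum_i a_i x^i$ over $\mathbb{C}_p$ the quantity is computed termwise, $\left[\left(\mathcal{D}\frac1x\right)^s g\right]_0=\sum_i a_i\left[\left(\mathcal{D}\frac1x\right)^s x^i\right]_0$, as a $p$-adic infinite sum. $\Gamma_p:\mathbb{Z}_p\to\mathbb{Z}_p^\times$ is the (Morita) $p$-adic Gamma function: the unique continuous function with $\Gamma_p(0)=1$, $\Gamma_p(x+1)=-x\Gamma_p(x)$ if $|x|=1$, and $\Gamma_p(x+1)=-\Gamma_p(x)$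 if $|x|<1$, where $|\cdot|$ is the $p$-adic norm. *)

theory Defs
  imports "HOL-Analysis.Analysis" "HOL-Computational_Algebra.Computational_Algebra"
begin

section \<open>The field of p-adic complex numbers\<close>

text \<open>
  \<open>real_normed_field\<close> is not available here: a p-adic field is not a real vector space.
\<close>

class complete_nonarch_field = field_char_0 + complete_space +
  fixes absv :: "'a \<Rightarrow> real"
  assumes dist_absv: "dist x y = absv (x - y)"
    and absv_mult: "absv (x * y) = absv x * absv y"
    and absv_add: "absv (x + y) \<le> max (absv x) (absv y)"

text \<open>
  If the absolute value extends the p-adic one, then by completeness the closure of the
  prime field is the completion of the rationals, that is, the field of p-adic numbers.
\<close>

definition Qp :: "'a::complete_nonarch_field set" where
  "Qp = closure \<rat>"

definition Zp :: "'a::complete_nonarch_field set" where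
  "Zp = {x \<in> Qp. absv x \<le> 1}"

definition Qp_algebraic :: "'a::complete_nonarch_field set" where
  "Qp_algebraic = {x. \<exists>P. P \<noteq> 0 \<and> (\<forall>i. coeff P i \<in> Qp) \<and> poly P x = 0}"

text \<open>
  The type \<open>'a\<close> is a completion of an algebraic closure of the p-adic numbers: it is
  complete, its absolute value is normalised by \<open>\<bar>p\<bar> = 1/p\<close>, and the elements algebraic over
  \<open>Qp\<close> form an algebraically closed dense subfield. This determines the valued field up to
  isometric isomorphism. The normalisation forces the restriction of the absolute value to the
  rationals to be the p-adic one.
\<close>

definition is_Cp :: "nat \<Rightarrow> 'a::complete_nonarch_field itself \<Rightarrow> bool" where
  "is_Cp p _ \<longleftrightarrow>
     absv (of_nat p :: 'a) = 1 / real p \<and>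
     (\<forall>P :: 'a poly. degree P > 0 \<and> (\<forall>i. coeff P i \<in> Qp_algebraic) \<longrightarrow>
        (\<exists>x\<in>Qp_algebraic. poly P x = 0)) \<and>
     closure (Qp_algebraic :: 'a set) = UNIV"

section \<open>The Dwork exponential\<close>

definition dwork_exp :: "nat \<Rightarrow> 'a::field_char_0 fps" where
  "dwork_exp p = fps_exp 1 oo (fps_const (1 / of_nat p) * fps_X ^ p + fps_X)"

section \<open>The operator \<open>\<D> 1/x\<close>\<close>

text \<open>
  A Laurent series with finitely many positive but possibly infinitely many negative powers
  of \<open>x\<close> is represented by its coefficient function \<open>int \<Rightarrow> 'a\<close>. (The type \<open>fls\<close> has
  the opposite finiteness condition.)
\<close>

definition laurent_monom :: "nat \<Rightarrow> int \<Rightarrow> 'a::comm_ring_1" where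
  "laurent_monom k n = (if n = int k then 1 else 0)"

definition div_x :: "(int \<Rightarrow> 'a::comm_ring_1) \<Rightarrow> int \<Rightarrow> 'a" where
  "div_x g n = g (n + 1)"

definition diff_x :: "(int \<Rightarrow> 'a::comm_ring_1) \<Rightarrow> int \<Rightarrow> 'a" where
  "diff_x g n = of_int (n + 1) * g (n + 1)"

text \<open>
  The coefficient of \<open>x^n\<close> in the \<open>i\<close>-th derivative of \<open>g\<close> is a multiple of \<open>g (n + i)\<close>,
  so the sum below is finite whenever \<open>g\<close> has finitely many positive powers.
\<close>

definition D_op :: "(int \<Rightarrow> 'a::comm_ring_1) \<Rightarrow> int \<Rightarrow> 'a" where
  "D_op g n = (\<Sum>i | (diff_x ^^ i) g n \<noteq> 0. (diff_x ^^ i) g n)"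

definition D_inv_x :: "(int \<Rightarrow> 'a::comm_ring_1) \<Rightarrow> int \<Rightarrow> 'a" where
  "D_inv_x g = D_op (div_x g)"

text \<open>
  Constant term of \<open>(\<D> 1/x)^s g\<close>, computed termwise: the relation says that the infinite sum
  converges to \<open>c\<close>.
\<close>

definition const_term_D_inv_x ::
    "nat \<Rightarrow> 'a::complete_nonarch_field fps \<Rightarrow> 'a \<Rightarrow> bool" where
  "const_term_D_inv_x s g c \<longleftrightarrow>
     (\<lambda>i. fps_nth g i * (D_inv_x ^^ s) (laurent_monom i) 0) sums c"

section \<open>The p-adic Gamma function and derivatives on the p-adic integers\<close>

definition is_Gamma_p :: "('a::complete_nonarch_field \<Rightarrow> 'a) \<Rightarrow> bool" where
  "is_Gamma_p G \<longleftrightarrow>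
     continuous_on Zp G \<and>
     (\<forall>x\<in>Zp. G x \<in> Zp \<and> absv (G x) = 1) \<and>
     G 0 = 1 \<and>
     (\<forall>x\<in>Zp. absv x = 1 \<longrightarrow> G (x + 1) = - x * G x) \<and>
     (\<forall>x\<in>Zp. absv x < 1 \<longrightarrow> G (x + 1) = - G x)"

text \<open>The value 0 outside \<open>Zp\<close> only serves to make the total function unique.\<close>

definition Gamma_p :: "'a::complete_nonarch_field \<Rightarrow> 'a" where
  "Gamma_p = (THE G. is_Gamma_p G \<and> (\<forall>x. x \<notin> Zp \<longrightarrow> G x = 0))"

definition has_Zp_deriv ::
    "('a::complete_nonarch_field \<Rightarrow> 'a) \<Rightarrow> 'a \<Rightarrow> 'a \<Rightarrow> bool" where
  "has_Zp_deriv f D x \<longleftrightarrow> ((\<lambda>y. (f y - f x) / (y - x)) \<longlongrightarrow> D) (at x within Zp)"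

definition Zp_deriv :: "('a::complete_nonarch_field \<Rightarrow> 'a) \<Rightarrow> 'a \<Rightarrow> 'a" where
  "Zp_deriv f x = (THE D. has_Zp_deriv f D x)"

text \<open>
  The derivatives of \<open>f\<close> up to order \<open>s\<close> exist near \<open>x\<close> in \<open>Zp\<close>, so that
  \<open>(Zp_deriv ^^ s) f x\<close> is meaningful.
\<close>

definition Zp_differentiable_times ::
    "nat \<Rightarrow> ('a::complete_nonarch_field \<Rightarrow> 'a) \<Rightarrow> 'a \<Rightarrow> bool" where
  "Zp_differentiable_times s f x \<longleftrightarrow>
     (\<exists>e>0. \<forall>k<s. \<forall>y\<in>Zp. dist y x < e \<longrightarrow> (\<exists>D. has_Zp_deriv ((Zp_deriv ^^ k) f) D y))"

end

theory Submission
  imports Defs "HOL-Number_Theory.Residues"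
begin

text \<open>
  The constant term of \<open>(\<D> 1/x)^s x^n\<close> is the coefficient of \<open>t^s\<close> in \<open>t(t+1)\<dots>(t+n-1)\<close>. So the
  claim is that, near \<open>t = 0\<close>, \<open>\<Gamma>\<^sub>p(-t)\<close> is the sum of the polynomials \<open>B\<^sub>n t(t+1)\<dots>(t+n-1)\<close>,
  expanded termwise. On the disc of radius \<open>1/p^2\<close> the Gauss norms of these polynomials tend to \<open>0\<close>:
  the recursion \<open>n B\<^sub>n = B\<^sub>n\<^sub>-\<^sub>1 + B\<^sub>n\<^sub>-\<^sub>p\<close> and Wilson's theorem show that \<open>n! B\<^sub>n\<close> gains a factor \<open>p\<close>
  in every \<open>2p\<close> steps, which beats the quotient of the Gauss norm by \<open>n!\<close>. So the sum is a power
  series \<open>g\<close> on this disc. At \<open>t = -m\<close> it is finite, and since \<open>exp(-x) f(x) = exp(x^p/p)\<close> it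
  equals \<open>(-1)^m m!/(p^l l!) = \<Gamma>\<^sub>p(m)\<close> for \<open>m = p l\<close>. The Lipschitz bound for \<open>g\<close> makes the recursively
  defined values \<open>\<Gamma>\<^sub>p(m)\<close> uniformly continuous, which yields the existence of \<open>\<Gamma>\<^sub>p\<close>, and \<open>\<Gamma>\<^sub>p = g\<close> on
  the disc by density.
\<close>

section \<open>Non-archimedean absolute values\<close>

lemma absv_0 [simp]: "absv (0::'a::complete_nonarch_field) = 0"
  using dist_absv[of "0::'a" 0] by simp

lemma absv_eq_0_iff [simp]: "absv x = 0 \<longleftrightarrow> x = (0::'a::complete_nonarch_field)"
  using dist_absv[of x 0] by auto

lemma absv_nonneg [simp]: "absv (x::'a::complete_nonarch_field) \<ge> 0"
  using dist_absv[of x 0] by (metis diff_zero zero_le_dist)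

lemma absv_1 [simp]: "absv (1::'a::complete_nonarch_field) = 1"
  using absv_mult[of "1::'a" 1] by simp

lemma absv_minus [simp]: "absv (- x) = absv (x::'a::complete_nonarch_field)"
  using dist_absv[of x 0] dist_absv[of 0 x] by (simp add: dist_commute)

lemma absv_minus_commute: "absv (x - y) = absv (y - x :: 'a::complete_nonarch_field)"
  using absv_minus[of "x - y"] by simp

lemma absv_power: "absv (x ^ n) = absv (x::'a::complete_nonarch_field) ^ n"
  by (induction n) (auto simp: absv_mult)

lemma absv_divide: "absv (x / y) = absv x / absv (y::'a::complete_nonarch_field)"
proof (cases "y = 0")
  case False
  then have "absv (x / y) * absv y = absv x"
    by (simp flip: absv_mult)
  with False show ?thesis
    by (simp add: field_simps)
qed auto

lemma absv_add_le:
  "absv x \<le> e \<Longrightarrow> absv y \<le> e \<Longrightarrow> absv (x + y :: 'a::complete_nonarch_field) \<le> e"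
  using absv_add[of x y] by linarith

lemma absv_diff_trans:
  "absv (x - y) \<le> e \<Longrightarrow> absv (y - z) \<le> e \<Longrightarrow> absv (x - z :: 'a::complete_nonarch_field) \<le> e"
  using absv_add_le[of "x - y" e "y - z"] by simp

lemma absv_sum_le:
  assumes "\<And>i. i \<in> A \<Longrightarrow> absv (f i :: 'a::complete_nonarch_field) \<le> e" "e \<ge> 0"
  shows "absv (sum f A) \<le> e"
  using assms(1) by (induction A rule: infinite_finite_induct) (auto intro: absv_add_le assms(2))

lemma absv_of_nat_le_1: "absv (of_nat n :: 'a::complete_nonarch_field) \<le> 1"
  by (induction n) (auto intro: absv_add_le)

lemma absv_of_int_le_1: "absv (of_int n :: 'a::complete_nonarch_field) \<le> 1"
  by (cases n rule: int_cases2) (auto simp: absv_of_nat_le_1)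

lemma absv_mult_le:
  "absv x \<le> a \<Longrightarrow> absv y \<le> b \<Longrightarrow> absv (x * y :: 'a::complete_nonarch_field) \<le> a * b"
  unfolding absv_mult
  by (intro mult_mono; use absv_nonneg[of x] absv_nonneg[of y] in linarith)

instance complete_nonarch_field \<subseteq> topological_ab_group_add
proof
  fix a b :: 'a
  show "((\<lambda>x. fst x + snd x) \<longlongrightarrow> a + b) (nhds a \<times>\<^sub>F nhds b)"
  proof (rule tendstoI)
    fix e :: real assume e: "e > 0"
    have "eventually (\<lambda>x. dist x a < e) (nhds a)" "eventually (\<lambda>x. dist x b < e) (nhds b)"
      using e by (auto simp: eventually_nhds_metric)
    then have "eventually (\<lambda>x. dist (fst x) a < e \<and> dist (snd x) b < e) (nhds a \<times>\<^sub>F nhds b)"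
      by (auto simp: eventually_prod_filter)
    then show "eventually (\<lambda>x. dist (fst x + snd x) (a + b) < e) (nhds a \<times>\<^sub>F nhds b)"
    proof eventually_elim
      case (elim x)
      then show ?case
        using absv_add[of "fst x - a" "snd x - b"]
        by (simp add: dist_absv add_diff_add less_max_iff_disj max_def split: if_splits)
    qed
  qed
  have "eventually (\<lambda>x. dist x a < e) (nhds a)" if "e > 0" for e
    using that by (auto simp: eventually_nhds_metric)
  then show "(uminus \<longlongrightarrow> - a) (nhds a)"
    by (intro tendstoI) (simp add: dist_absv absv_minus_commute)
qed

instance complete_nonarch_field \<subseteq> topological_semigroup_mult
proof
  fix a b :: 'a
  show "((\<lambda>x. fst x * snd x) \<longlongrightarrow> a * b) (nhds a \<times>\<^sub>F nhds b)"
  proof (rule tendstoI)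
    fix e :: real assume e: "e > 0"
    define d where "d = min 1 (e / (1 + absv a + absv b))"
    have pos: "1 + absv a + absv b > 0"
      using absv_nonneg[of a] absv_nonneg[of b] by linarith
    have d: "d > 0" "d \<le> 1"
      using e pos by (auto simp: d_def)
    have "d \<le> e / (1 + absv a + absv b)"
      by (simp add: d_def)
    then have de: "d * (1 + absv a + absv b) \<le> e"
      using pos by (simp only: pos_le_divide_eq)
    have "eventually (\<lambda>x. dist x a < d) (nhds a)" "eventually (\<lambda>x. dist x b < d) (nhds b)"
      using d by (auto simp: eventually_nhds_metric)
    then have "eventually (\<lambda>x. dist (fst x) a < d \<and> dist (snd x) b < d) (nhds a \<times>\<^sub>F nhds b)"
      by (auto simp: eventually_prod_filter)
    then show "eventually (\<lambda>x. dist (fst x * snd x) (a * b) < e) (nhds a \<times>\<^sub>F nhds b)"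
    proof eventually_elim
      case (elim x)
      define u v where "u = fst x - a" and "v = snd x - b"
      have uv: "absv u < d" "absv v < d"
        using elim by (auto simp: u_def v_def dist_absv)
      have eq: "fst x * snd x - a * b = u * v + a * v + u * b"
        by (simp add: u_def v_def algebra_simps)
      have "absv (u * v + a * v + u * b) \<le> max (absv u * absv v) (max (absv a * absv v) (absv u * absv b))"
        using absv_add[of "u * v + a * v" "u * b"] absv_add[of "u * v" "a * v"]
        by (simp add: absv_mult)
      also have "\<dots> < e"
      proof -
        have "absv a * absv v \<le> absv a * d" "absv u * absv b \<le> d * absv b"
          using uv d by (auto intro!: mult_mono)
        moreover have "absv u * absv v < d"
          using uv d mult_left_mono[of "absv v" 1 "absv u"] absv_nonneg[of u] by linarith
        moreover have "0 \<le> d * absv a" "0 \<le> d * absv b" "d + d * absv a + d * absv b \<le> e"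
          using d de by (auto simp: algebra_simps)
        ultimately show ?thesis
          using d unfolding max_less_iff_conj mult.commute[of "absv a" d]
          by (intro conjI; linarith)
      qed
      finally show ?case
        by (simp add: dist_absv eq)
    qed
  qed
qed

lemma tendsto_absv:
  fixes f :: "'b \<Rightarrow> 'a::complete_nonarch_field"
  assumes "(f \<longlongrightarrow> l) F"
  shows "((\<lambda>x. absv (f x)) \<longlongrightarrow> absv l) F"
  using tendsto_dist[OF assms tendsto_const, of 0] by (simp add: dist_absv)

lemma tendsto_0_absv:
  fixes f :: "'b \<Rightarrow> 'a::complete_nonarch_field"
  shows "(f \<longlongrightarrow> 0) F \<longleftrightarrow> ((\<lambda>x. absv (f x)) \<longlongrightarrow> 0) F"
  by (simp add: tendsto_iff dist_absv)

lemma absv_limit_le: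
  fixes f :: "nat \<Rightarrow> 'a::complete_nonarch_field"
  assumes "f \<longlonglongrightarrow> l" "eventually (\<lambda>n. absv (f n) \<le> e) sequentially"
  shows "absv l \<le> e"
  using tendsto_upperbound[OF tendsto_absv[OF assms(1)] assms(2)] by simp

lemma nonarch_summable:
  fixes a :: "nat \<Rightarrow> 'a::complete_nonarch_field"
  assumes "(\<lambda>n. absv (a n)) \<longlonglongrightarrow> 0"
  shows "summable a"
proof -
  have "Cauchy (\<lambda>n. sum a {..<n})"
  proof (rule metric_CauchyI)
    fix e :: real assume e: "e > 0"
    then obtain N where N: "\<And>n. n \<ge> N \<Longrightarrow> absv (a n) < e / 2"
      using LIMSEQ_D[OF assms, of "e / 2"] by auto
    have le: "absv (sum a {..<n} - sum a {..<m}) < e" if "N \<le> m" "m \<le> n" for m n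
    proof -
      have "sum a {..<n} - sum a {..<m} = sum a {m..<n}"
        using that sum_diff_nat_ivl[of 0 m n a] by (simp add: atLeast0LessThan)
      moreover have "absv (sum a {m..<n}) \<le> e / 2"
        using that N e by (intro absv_sum_le) (auto intro: less_imp_le)
      ultimately show ?thesis using e by simp
    qed
    show "\<exists>M. \<forall>m\<ge>M. \<forall>n\<ge>M. dist (sum a {..<m}) (sum a {..<n}) < e"
    proof (intro exI allI impI)
      fix m n assume "N \<le> m" "N \<le> n"
      then show "dist (sum a {..<m}) (sum a {..<n}) < e"
        using le[of m n] le[of n m] by (cases "m \<le> n") (auto simp: dist_absv absv_minus_commute)
    qed
  qed
  then have "convergent (\<lambda>n. sum a {..<n})"
    by (simp add: Cauchy_convergent)
  then show ?thesis
    by (simp add: summable_iff_convergent)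
qed

lemma nonarch_sums_tail_le:
  fixes a :: "nat \<Rightarrow> 'a::complete_nonarch_field"
  assumes "a sums c" "\<And>n. n \<ge> N \<Longrightarrow> absv (a n) \<le> e"
  shows "absv (c - sum a {..<N}) \<le> e"
proof (rule absv_limit_le)
  show "(\<lambda>n. sum a {..<n} - sum a {..<N}) \<longlonglongrightarrow> c - sum a {..<N}"
    using assms(1) unfolding sums_def by (intro tendsto_diff tendsto_const)
  have e: "e \<ge> 0" using assms(2)[of N] absv_nonneg[of "a N"] by linarith
  show "\<forall>\<^sub>F n in sequentially. absv (sum a {..<n} - sum a {..<N}) \<le> e"
    unfolding eventually_sequentially
  proof (intro exI allI impI)
    fix n assume "N \<le> n"
    then have "sum a {..<n} - sum a {..<N} = sum a {N..<n}"
      using sum_diff_nat_ivl[of 0 N n a] by (simp add: atLeast0LessThan)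
    then show "absv (sum a {..<n} - sum a {..<N}) \<le> e"
      using assms(2) e by (auto intro: absv_sum_le)
  qed
qed

section \<open>Power series on a disc\<close>

locale nonarch_power_series =
  fixes a :: "nat \<Rightarrow> 'a::complete_nonarch_field" and r :: real
  assumes r_pos: "r > 0" and coeff_null: "(\<lambda>n. absv (a n) * r ^ n) \<longlonglongrightarrow> 0"
begin

definition psum :: "'a \<Rightarrow> 'a" where
  "psum x = (\<Sum>n. a n * x ^ n)"

lemma psum_sums: "absv x \<le> r \<Longrightarrow> (\<lambda>n. a n * x ^ n) sums psum x"
  unfolding psum_def
proof (rule summable_sums, rule nonarch_summable)
  assume x: "absv x \<le> r"
  have "absv (a n * x ^ n) \<le> absv (a n) * r ^ n" for n
    using x by (auto simp: absv_mult absv_power intro!: mult_left_mono power_mono)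
  then show "(\<lambda>n. absv (a n * x ^ n)) \<longlonglongrightarrow> 0"
    by (intro tendsto_sandwich[OF _ _ tendsto_const coeff_null]) auto
qed

lemma psum_0: "psum 0 = a 0"
proof -
  have "(\<lambda>n. a n * 0 ^ n) sums a 0"
    using sums_single[of 0 "\<lambda>n. a n * 0 ^ n"] by (simp add: power_0_left if_distrib cong: if_cong)
  then show ?thesis
    using psum_sums[of 0] r_pos sums_unique2 by fastforce
qed

lemma coeff_bound: obtains C where "C > 0" "\<And>n. absv (a n) * r ^ n \<le> C"
proof -
  have "Bseq (\<lambda>n. absv (a n) * r ^ n)"
    using coeff_null by (auto intro: convergent_imp_Bseq convergentI)
  then obtain K where "K > 0" "\<And>n. norm (absv (a n) * r ^ n) \<le> K"
    by (auto elim: BseqE)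
  with that[of K] show ?thesis
    using r_pos by (auto simp: abs_mult)
qed

lemma diffs_power_series: "nonarch_power_series (diffs a) r"
proof
  have "(\<lambda>n. absv (a (Suc n)) * r ^ Suc n / r) \<longlonglongrightarrow> 0 / r"
    using r_pos by (intro tendsto_divide[OF LIMSEQ_Suc[OF coeff_null] tendsto_const]) auto
  then have lim: "(\<lambda>n. absv (a (Suc n)) * r ^ n) \<longlonglongrightarrow> 0"
    using r_pos by simp
  have "absv (diffs a n) * r ^ n \<le> absv (a (Suc n)) * r ^ n" for n
    using r_pos absv_of_nat_le_1[of "Suc n", where 'a='a]
    unfolding diffs_def absv_mult by (intro mult_right_mono mult_left_le_one_le) auto
  then show "(\<lambda>n. absv (diffs a n) * r ^ n) \<longlonglongrightarrow> 0"
    using r_pos by (intro tendsto_sandwich[OF _ _ tendsto_const lim]) auto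
qed (fact r_pos)

end

lemma absv_power_le: "absv x \<le> r \<Longrightarrow> absv (x ^ n) \<le> r ^ n" for x :: "'a::complete_nonarch_field"
  by (simp add: absv_power power_mono)

lemma absv_power_diff_le:
  fixes x y :: "'a::complete_nonarch_field"
  assumes "absv x \<le> r" "absv y \<le> r"
  shows "absv (y ^ n - x ^ n) * r \<le> absv (y - x) * r ^ n"
proof (induction n)
  case 0
  have "r \<ge> 0" using assms(1) absv_nonneg[of x] by linarith
  then show ?case by simp
next
  case (Suc n)
  have r: "r \<ge> 0" using assms(1) absv_nonneg[of x] by linarith
  have "y ^ Suc n - x ^ Suc n = y * (y ^ n - x ^ n) + (y - x) * x ^ n"
    by (simp add: algebra_simps)
  moreover have "absv (y * (y ^ n - x ^ n)) * r \<le> absv (y - x) * r ^ Suc n"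
  proof -
    have "absv y * (absv (y ^ n - x ^ n) * r) \<le> r * (absv (y - x) * r ^ n)"
      by (rule mult_mono[OF assms(2) Suc r]) (simp add: r)
    then show ?thesis by (simp add: absv_mult mult_ac)
  qed
  moreover have "absv ((y - x) * x ^ n) * r \<le> absv (y - x) * r ^ Suc n"
    using mult_left_mono[OF absv_power_le[OF assms(1), of n], of "absv (y - x) * r"] r
    by (simp add: absv_mult mult_ac)
  ultimately show ?case
    using r absv_add[of "y * (y ^ n - x ^ n)" "(y - x) * x ^ n"]
    by (smt (verit) mult_right_mono)
qed

lemma absv_power_taylor_le:
  fixes x y :: "'a::complete_nonarch_field"
  assumes "absv x \<le> r" "absv y \<le> r"
  shows "absv (y ^ n - x ^ n - of_nat n * x ^ (n - 1) * (y - x)) * r\<^sup>2 \<le> absv (y - x) ^ 2 * r ^ n"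
proof (induction n)
  case 0
  then show ?case by simp
next
  case (Suc n)
  have r: "r \<ge> 0" using assms(1) absv_nonneg[of x] by linarith
  let ?T = "y ^ n - x ^ n - of_nat n * x ^ (n - 1) * (y - x)"
  let ?S = "of_nat n * x ^ (n - 1) * (y - x)\<^sup>2"
  have eq: "y ^ Suc n - x ^ Suc n - of_nat (Suc n) * x ^ (Suc n - 1) * (y - x) = y * ?T + ?S"
    by (cases n) (simp_all add: algebra_simps power2_eq_square)
  have "absv (y * ?T) * r\<^sup>2 \<le> absv (y - x) ^ 2 * r ^ Suc n"
  proof -
    have "absv y * (absv ?T * r\<^sup>2) \<le> r * (absv (y - x) ^ 2 * r ^ n)"
      by (rule mult_mono[OF assms(2) Suc r]) simp
    then show ?thesis by (simp only: absv_mult mult_ac power_Suc)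
  qed
  moreover have "absv ?S * r\<^sup>2 \<le> absv (y - x) ^ 2 * r ^ Suc n"
  proof (cases n)
    case 0
    then show ?thesis using r by simp
  next
    case (Suc m)
    have "absv (of_nat n * x ^ m) \<le> 1 * r ^ m"
      by (intro absv_mult_le absv_of_nat_le_1 absv_power_le assms)
    then have "absv (of_nat n * x ^ m) * (absv (y - x) ^ 2 * r\<^sup>2) \<le> r ^ m * (absv (y - x) ^ 2 * r\<^sup>2)"
      by (intro mult_right_mono) auto
    then show ?thesis
      using Suc by (simp add: absv_mult absv_power power2_eq_square mult_ac)
  qed
  ultimately show ?case
    unfolding eq using r absv_add[of "y * ?T" ?S] zero_le_power2[of r]
    by (smt (verit) mult_right_mono)
qed

context nonarch_power_series
begin

lemma psum_lipschitz:
  obtains L where "L > 0"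
    "\<And>x y. absv x \<le> r \<Longrightarrow> absv y \<le> r \<Longrightarrow> absv (psum y - psum x) \<le> L * absv (y - x)"
proof -
  obtain C where C: "C > 0" "\<And>n. absv (a n) * r ^ n \<le> C"
    using coeff_bound by blast
  have "absv (psum y - psum x) \<le> (C / r) * absv (y - x)" if xy: "absv x \<le> r" "absv y \<le> r" for x y
  proof (rule absv_limit_le)
    show "(\<lambda>N. (\<Sum>n<N. a n * y ^ n) - (\<Sum>n<N. a n * x ^ n)) \<longlonglongrightarrow> psum y - psum x"
      using psum_sums[OF xy(1)] psum_sums[OF xy(2)] unfolding sums_def by (intro tendsto_diff)
    have "absv (a n * (y ^ n - x ^ n)) \<le> C / r * absv (y - x)" for n
    proof -
      have "absv (a n) * (absv (y ^ n - x ^ n) * r) \<le> absv (a n) * (absv (y - x) * r ^ n)"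
        by (intro mult_left_mono absv_power_diff_le xy) auto
      also have "\<dots> \<le> C * absv (y - x)"
        using mult_right_mono[OF C(2)[of n], of "absv (y - x)"] by (simp add: mult_ac)
      finally have "absv (a n * (y ^ n - x ^ n)) * r \<le> C * absv (y - x)"
        by (simp only: absv_mult mult.assoc)
      then show ?thesis
        using r_pos by (simp only: pos_le_divide_eq times_divide_eq_left)
    qed
    then show "\<forall>\<^sub>F N in sequentially.
        absv ((\<Sum>n<N. a n * y ^ n) - (\<Sum>n<N. a n * x ^ n)) \<le> C / r * absv (y - x)"
      using C(1) r_pos unfolding sum_subtractf[symmetric] right_diff_distrib[symmetric]
      by (intro always_eventually allI absv_sum_le) auto
  qed
  with that[of "C / r"] C(1) r_pos show ?thesis by simp
qed

lemma psum_taylor: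
  obtains L where "L > 0"
    "\<And>x y. absv x \<le> r \<Longrightarrow> absv y \<le> r \<Longrightarrow>
       absv (psum y - psum x - nonarch_power_series.psum (diffs a) x * (y - x)) \<le> L * absv (y - x) ^ 2"
proof -
  interpret D: nonarch_power_series "diffs a" r
    by (rule diffs_power_series)
  obtain C where C: "C > 0" "\<And>n. absv (a n) * r ^ n \<le> C"
    using coeff_bound by blast
  have "absv (psum y - psum x - D.psum x * (y - x)) \<le> (C / r\<^sup>2) * absv (y - x) ^ 2"
    if xy: "absv x \<le> r" "absv y \<le> r" for x y
  proof (rule absv_limit_le)
    show "(\<lambda>N. (\<Sum>n<Suc N. a n * y ^ n) - (\<Sum>n<Suc N. a n * x ^ n)
             - (\<Sum>n<N. diffs a n * x ^ n) * (y - x)) \<longlonglongrightarrow> psum y - psum x - D.psum x * (y - x)"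
      using psum_sums[OF xy(1)] psum_sums[OF xy(2)] D.psum_sums[OF xy(1)] unfolding sums_def
      by (intro tendsto_diff tendsto_mult tendsto_const) (auto dest: LIMSEQ_Suc)
    have shift: "(\<Sum>n<N. diffs a n * x ^ n) = (\<Sum>n<Suc N. a n * (of_nat n * x ^ (n - 1)))" for N
      by (subst sum.lessThan_Suc_shift) (simp add: diffs_def mult_ac)
    have eq: "(\<Sum>n<Suc N. a n * y ^ n) - (\<Sum>n<Suc N. a n * x ^ n) - (\<Sum>n<N. diffs a n * x ^ n) * (y - x)
        = (\<Sum>n<Suc N. a n * (y ^ n - x ^ n - of_nat n * x ^ (n - 1) * (y - x)))" for N
      unfolding shift sum_distrib_right sum_subtractf[symmetric]
      by (intro sum.cong) (auto simp: algebra_simps)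
    have "absv (a n * (y ^ n - x ^ n - of_nat n * x ^ (n - 1) * (y - x))) \<le> C / r\<^sup>2 * absv (y - x) ^ 2" for n
    proof -
      have "absv (a n) * (absv (y ^ n - x ^ n - of_nat n * x ^ (n - 1) * (y - x)) * r\<^sup>2)
          \<le> absv (a n) * (absv (y - x) ^ 2 * r ^ n)"
        by (intro mult_left_mono absv_power_taylor_le xy) auto
      also have "\<dots> \<le> C * absv (y - x) ^ 2"
        using mult_right_mono[OF C(2)[of n], of "absv (y - x) ^ 2"] by (simp add: mult_ac)
      finally have "absv (a n * (y ^ n - x ^ n - of_nat n * x ^ (n - 1) * (y - x))) * r\<^sup>2 \<le> C * absv (y - x) ^ 2"
        by (simp only: absv_mult mult.assoc)
      then show ?thesis
        using r_pos by (simp only: pos_le_divide_eq times_divide_eq_left zero_less_power)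
    qed
    then show "\<forall>\<^sub>F N in sequentially.
        absv ((\<Sum>n<Suc N. a n * y ^ n) - (\<Sum>n<Suc N. a n * x ^ n) - (\<Sum>n<N. diffs a n * x ^ n) * (y - x))
          \<le> C / r\<^sup>2 * absv (y - x) ^ 2"
      unfolding eq using C(1) by (intro always_eventually allI absv_sum_le) auto
  qed
  with that[of "C / r\<^sup>2"] C(1) r_pos show ?thesis by simp
qed

end

lemma diffs_funpow: "(diffs ^^ k) a n * fact n = fact (n + k) * a (n + k)"
  for a :: "nat \<Rightarrow> 'a::field_char_0"
proof (induction k arbitrary: n)
  case (Suc k)
  have "(diffs ^^ Suc k) a n * fact n = (diffs ^^ k) a (Suc n) * fact (Suc n)"
    by (simp add: diffs_def algebra_simps)
  also have "\<dots> = fact (Suc n + k) * a (Suc n + k)"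
    by (rule Suc)
  finally show ?case
    by (simp only: add_Suc add_Suc_right)
qed simp

section \<open>The constant term functional on monomials\<close>

lemma diff_x_funpow_eq_0:
  assumes "\<And>m. m > K \<Longrightarrow> g m = 0" "n + int i > K"
  shows "(diff_x ^^ i) g n = 0"
  using assms(2)
proof (induction i arbitrary: n)
  case (Suc i)
  then show ?case
    using Suc.IH[of "n + 1"] by (simp add: diff_x_def)
qed (use assms(1) in simp)

lemma D_op_eq_sum:
  assumes "\<And>m. m > K \<Longrightarrow> g m = 0" "n + int N > K"
  shows "D_op g n = (\<Sum>i<N. (diff_x ^^ i) g n)"
  unfolding D_op_def
proof (rule sum.mono_neutral_left)
  show "{i. (diff_x ^^ i) g n \<noteq> 0} \<subseteq> {..<N}"
  proof (intro subsetI, rule ccontr)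
    fix i assume "i \<in> {i. (diff_x ^^ i) g n \<noteq> 0}" "i \<notin> {..<N}"
    then show False
      using diff_x_funpow_eq_0[of K g n i] assms by simp
  qed
qed auto

lemma D_op_rec:
  assumes "\<And>m. m > K \<Longrightarrow> g m = 0"
  shows "D_op g n = g n + of_int (n + 1) * D_op g (n + 1)"
proof -
  define N where "N = nat (K + 1 - n)"
  have "D_op g n = (\<Sum>i<Suc N. (diff_x ^^ i) g n)"
    by (rule D_op_eq_sum[OF assms]) (auto simp: N_def)
  also have "\<dots> = g n + (\<Sum>i<N. (diff_x ^^ Suc i) g n)"
    by (subst sum.lessThan_Suc_shift) simp
  also have "(\<Sum>i<N. (diff_x ^^ Suc i) g n) = of_int (n + 1) * (\<Sum>i<N. (diff_x ^^ i) g (n + 1))"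
    by (simp add: diff_x_def sum_distrib_left)
  also have "(\<Sum>i<N. (diff_x ^^ i) g (n + 1)) = D_op g (n + 1)"
    by (rule D_op_eq_sum[OF assms, symmetric]) (auto simp: N_def)
  finally show ?thesis .
qed

lemma D_inv_x_eq_0:
  assumes "\<And>m. m > K \<Longrightarrow> g m = 0" "m \<ge> K"
  shows "D_inv_x g m = 0"
  unfolding D_inv_x_def
  by (subst D_op_eq_sum[where K = "K - 1" and N = 0]) (use assms in \<open>auto simp: div_x_def\<close>)

lemma D_inv_x_rec:
  assumes "\<And>m. m > K \<Longrightarrow> g m = 0"
  shows "D_inv_x g n = g (n + 1) + of_int (n + 1) * D_inv_x g (n + 1)"
  unfolding D_inv_x_def
  by (subst D_op_rec[where K = "K - 1"]) (use assms in \<open>auto simp: div_x_def\<close>)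

lemma D_inv_x_funpow_eq_0:
  assumes "m > int k - int s"
  shows "(D_inv_x ^^ s) (laurent_monom k) m = (0 :: 'a::comm_ring_1)"
  using assms
proof (induction s arbitrary: m)
  case (Suc s)
  then have "D_inv_x ((D_inv_x ^^ s) (laurent_monom k)) m = (0::'a)"
    by (intro D_inv_x_eq_0[where K = "int k - int s"]) auto
  then show ?case by simp
qed (auto simp: laurent_monom_def)

lemma D_inv_x_funpow_rec:
  "(D_inv_x ^^ Suc s) (laurent_monom k) n =
     (D_inv_x ^^ s) (laurent_monom k) (n + 1) +
     of_int (n + 1) * (D_inv_x ^^ Suc s) (laurent_monom k) (n + 1)"
  unfolding funpow.simps comp_def
  by (rule D_inv_x_rec[where K = "int k - int s"], rule D_inv_x_funpow_eq_0)

lemma coeff_linear_times_Suc: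
  "Polynomial.coeff ([:c, 1:] * P) (Suc s) = c * Polynomial.coeff P (Suc s) + Polynomial.coeff P s" for P :: "'a::comm_ring_1 poly"
  by simp

text \<open>
  The recursion \<open>\<D> = 1 + \<partial> \<D>\<close> gives the coefficient of \<open>x^n\<close> in terms of that of \<open>x^(n+1)\<close>,
  so we descend from \<open>n = k - 1\<close> to \<open>n = 0\<close>.
\<close>

lemma D_inv_x_funpow_coeff:
  assumes "n < k"
  shows "(D_inv_x ^^ s) (laurent_monom k) (int n) =
    Polynomial.coeff ([:0, 1:] * (\<Prod>j\<in>{Suc n..<k}. [:of_nat j, 1:]) :: 'a::comm_ring_1 poly) s"
proof -
  have "n \<le> k - 1" using assms by simp
  then show ?thesis
  proof (induction n arbitrary: s rule: inc_induct)
    case base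
    have k: "int (k - 1) + 1 = int k"
      using assms by simp
    show ?case
    proof (cases s)
      case 0
      then show ?thesis using assms by (simp add: laurent_monom_def)
    next
      case (Suc s')
      have "(D_inv_x ^^ s) (laurent_monom k) (int (k - 1)) = (D_inv_x ^^ s') (laurent_monom k) (int k :: int) + (of_int (int k) :: 'a) * (D_inv_x ^^ s) (laurent_monom k) (int k)"
        unfolding Suc D_inv_x_funpow_rec[of s' k "int (k - 1)"] k ..
      also have "(D_inv_x ^^ s) (laurent_monom k) (int k) = (0::'a)"
        by (rule D_inv_x_funpow_eq_0) (use Suc in simp)
      also have "(D_inv_x ^^ s') (laurent_monom k) (int k) = (if s' = 0 then 1 else (0::'a))"
        using D_inv_x_funpow_eq_0[of k s' "int k"] by (auto simp: laurent_monom_def)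
      finally show ?thesis
        using assms Suc by (simp add: coeff_pCons split: nat.split)
    qed
  next
    case (step n)
    have "{Suc n..<k} = insert (Suc n) {Suc (Suc n)..<k}"
      using step assms by auto
    then have prod: "[:0, 1:] * (\<Prod>j\<in>{Suc n..<k}. [:of_nat j, 1:]) =
        [:of_nat (Suc n), 1:] * ([:0, 1:] * (\<Prod>j\<in>{Suc (Suc n)..<k}. [:of_nat j, 1:]) :: 'a poly)"
      by (simp only: prod.insert finite_atLeastLessThan atLeastLessThan_iff mult_ac) simp
    have n: "int n + 1 = int (Suc n)" by simp
    show ?case
    proof (cases s)
      case 0
      then show ?thesis using step.hyps by (simp add: laurent_monom_def)
    next
      case (Suc s')
      have "(D_inv_x ^^ s) (laurent_monom k) (int n) =
          (D_inv_x ^^ s') (laurent_monom k) (int (Suc n)) +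
          (of_int (int (Suc n)) :: 'a) * (D_inv_x ^^ s) (laurent_monom k) (int (Suc n))"
        unfolding Suc D_inv_x_funpow_rec[of s' k "int n"] n ..
      then show ?thesis
        unfolding step.IH prod Suc coeff_linear_times_Suc of_int_of_nat_eq by (simp only: add_ac)
    qed
  qed
qed

lemma pochhammer_pX: "pochhammer [:0, 1:] n = (\<Prod>j<n. [:of_nat j, 1 :: 'a::comm_ring_1:])"
  by (simp add: pochhammer_prod of_nat_poly atLeast0LessThan)

lemma D_inv_x_const_term:
  "(D_inv_x ^^ s) (laurent_monom k) 0 = Polynomial.coeff (pochhammer [:0, 1:] k :: 'a::comm_ring_1 poly) s"
proof (cases k)
  case 0
  have "(D_inv_x ^^ s) (laurent_monom 0) 0 = (if s = 0 then 1 else (0::'a))"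
    using D_inv_x_funpow_eq_0[of 0 s 0] by (auto simp: laurent_monom_def)
  then show ?thesis using 0 by simp
next
  case (Suc k')
  have "{..<k} = insert 0 {Suc 0..<k}"
    using Suc by auto
  then have "pochhammer [:0, 1:] k = [:0, 1:] * (\<Prod>j\<in>{Suc 0..<k}. [:of_nat j, 1 :: 'a:])"
    unfolding pochhammer_pX by simp
  then show ?thesis
    using D_inv_x_funpow_coeff[of 0 k s] Suc by simp
qed

lemma poly_pochhammer_pX: "poly (pochhammer [:0, 1:] n) x = pochhammer x n"
  for x :: "'a::comm_ring_1"
  by (induction n) (auto simp: pochhammer_Suc of_nat_poly algebra_simps)

section \<open>Coefficients of the Dwork exponential\<close>

lemma fps_deriv_dwork_exp:
  assumes "p > 0"
  shows "fps_deriv (dwork_exp p :: 'a::field_char_0 fps) = (1 + fps_X ^ (p - 1)) * dwork_exp p"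
proof -
  let ?g = "fps_const (1 / of_nat p) * fps_X ^ p + fps_X :: 'a fps"
  have "?g $ 0 = 0" using assms by (simp add: fps_X_power_nth)
  then have "fps_deriv (fps_exp 1 oo ?g) = (fps_deriv (fps_exp 1) oo ?g) * fps_deriv ?g"
    by (rule fps_compose_deriv)
  moreover have "fps_deriv ?g = fps_X ^ (p - 1) + 1"
    using assms by (simp add: fps_deriv_power fps_const_mult[symmetric] del: fps_const_mult)
  ultimately show ?thesis
    by (simp add: dwork_exp_def add_ac mult_ac)
qed

lemma dwork_exp_nth_0: "p > 0 \<Longrightarrow> dwork_exp p $ 0 = (1 :: 'a::field_char_0)"
  by (simp add: dwork_exp_def fps_compose_nth_0 fps_X_power_nth)

lemma dwork_exp_nth_Suc:
  assumes "p > 0"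
  shows "of_nat (Suc n) * (dwork_exp p $ Suc n :: 'a::field_char_0) =
     dwork_exp p $ n + (if Suc n < p then 0 else dwork_exp p $ (Suc n - p))"
proof -
  have "fps_deriv (dwork_exp p) $ n = ((1 + fps_X ^ (p - 1)) * dwork_exp p) $ n"
    by (simp only: fps_deriv_dwork_exp[OF assms])
  moreover have "n < p - 1 \<longleftrightarrow> Suc n < p" "n - (p - 1) = Suc n - p"
    using assms by auto
  ultimately show ?thesis
    by (simp only: distrib_right fps_add_nth fps_X_power_mult_nth fps_deriv_nth mult_1_left Suc_eq_plus1)
qed

section \<open>Integers in a p-adic field\<close>

locale padic =
  fixes p :: nat and ty :: "'a::complete_nonarch_field itself"
  assumes prime_p: "prime p" and odd_p: "odd p"
    and absv_p: "absv (of_nat p :: 'a) = 1 / real p"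
begin

lemma p_gt_0: "p > 0"
  using prime_p by (simp add: prime_gt_0_nat)

lemma p_ge_3: "p \<ge> 3"
  using prime_p odd_p prime_ge_2_nat[of p] by (cases "p = 2") auto

lemma absv_of_nat_not_dvd:
  assumes "\<not> p dvd n"
  shows "absv (of_nat n :: 'a) = 1"
proof -
  have "coprime n p"
    using prime_imp_coprime[OF prime_p assms] by (simp add: coprime_commute)
  then obtain u v where "u * int n + v * int p = 1"
    using bezout_int[of "int n" "int p"] by auto
  then have "of_int (u * int n + v * int p) = (1::'a)"
    by simp
  then have "of_int u * of_nat n + of_int v * of_nat p = (1::'a)"
    by simp
  then have "1 \<le> max (absv (of_int u * of_nat n :: 'a)) (absv (of_int v * of_nat p :: 'a))"
    using absv_add[of "of_int u * of_nat n :: 'a" "of_int v * of_nat p"] by simp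
  moreover have "absv (of_int v * of_nat p :: 'a) \<le> 1 * (1 / real p)"
    by (rule absv_mult_le[OF absv_of_int_le_1]) (simp add: absv_p)
  moreover have "absv (of_int u * of_nat n :: 'a) \<le> 1 * absv (of_nat n :: 'a)"
    by (rule absv_mult_le[OF absv_of_int_le_1]) simp
  moreover have "1 / real p < 1"
    using p_ge_3 by simp
  ultimately show ?thesis
    using absv_of_nat_le_1[of n, where 'a='a] by (simp add: max_def split: if_splits)
qed

lemma absv_of_nat_p_mult: "absv (of_nat (p * n) :: 'a) = absv (of_nat n :: 'a) / real p"
  by (simp add: absv_mult absv_p)

lemma absv_of_nat_less_1_iff: "absv (of_nat n :: 'a) < 1 \<longleftrightarrow> p dvd n"
proof
  assume "p dvd n"
  then obtain m where "n = p * m" by (elim dvdE)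
  then show "absv (of_nat n :: 'a) < 1"
    unfolding \<open>n = p * m\<close> absv_of_nat_p_mult
    using absv_of_nat_le_1[of m, where 'a='a] p_ge_3 by (simp add: divide_less_eq)
qed (use absv_of_nat_not_dvd[of n] in force)

lemma absv_of_nat_le_iff: "absv (of_nat n :: 'a) \<le> 1 / real p ^ k \<longleftrightarrow> p ^ k dvd n"
proof (induction k arbitrary: n)
  case 0
  then show ?case by (simp add: absv_of_nat_le_1)
next
  case (Suc k)
  have lt: "1 / real p ^ Suc k < 1"
    using p_ge_3 by (simp add: one_less_power del: power_Suc)
  show ?case
  proof (cases "p dvd n")
    case True
    then obtain m where m: "n = p * m" by (elim dvdE)
    have "absv (of_nat n :: 'a) \<le> 1 / real p ^ Suc k \<longleftrightarrow> absv (of_nat m :: 'a) \<le> 1 / real p ^ k"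
      unfolding m absv_of_nat_p_mult using p_gt_0 by (simp add: field_simps)
    then show ?thesis
      using Suc[of m] p_gt_0 by (simp add: m)
  next
    case False
    then have "\<not> p ^ Suc k dvd n"
      by (auto dest: dvd_mult_left)
    then show ?thesis
      using absv_of_nat_not_dvd[OF False] lt by simp
  qed
qed

lemma absv_of_int_le_iff: "absv (of_int z :: 'a) \<le> 1 / real p ^ k \<longleftrightarrow> int p ^ k dvd z"
proof -
  have "absv (of_int z :: 'a) = absv (of_nat (nat \<bar>z\<bar>) :: 'a)"
    by (cases z rule: int_cases2) auto
  moreover have "p ^ k dvd nat \<bar>z\<bar> \<longleftrightarrow> int p ^ k dvd z"
    by (simp add: nat_dvd_iff flip: of_nat_power)
  ultimately show ?thesis
    by (simp only: absv_of_nat_le_iff)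
qed

lemma absv_of_nat_ge: "n > 0 \<Longrightarrow> absv (of_nat n :: 'a) \<ge> 1 / real n"
proof (induction n rule: less_induct)
  case (less n)
  show ?case
  proof (cases "p dvd n")
    case True
    then obtain m where m: "n = p * m" by (elim dvdE)
    then have "m < n" "m > 0" using less.prems p_ge_3 by auto
    then have "1 / real m \<le> absv (of_nat m :: 'a)"
      by (rule less.IH)
    then show ?thesis
      unfolding m absv_of_nat_p_mult using p_gt_0 by (simp add: field_simps)
  next
    case False
    then show ?thesis
      using absv_of_nat_not_dvd less.prems by simp
  qed
qed

lemma absv_fact_div_p: "absv (fact n :: 'a) = absv (fact (n div p) :: 'a) / real p ^ (n div p)"
proof (induction n)
  case (Suc n)
  have fact: "absv (fact (Suc n) :: 'a) = absv (of_nat (Suc n) :: 'a) * absv (fact n :: 'a)"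
    by (simp only: fact_Suc absv_mult)
  show ?case
  proof (cases "p dvd Suc n")
    case True
    then obtain m where m: "Suc n = p * m" by (elim dvdE)
    have "Suc n div p = Suc (n div p)"
      using True by (simp add: div_Suc dvd_eq_mod_eq_0)
    moreover have "Suc n div p = m"
      unfolding m using p_gt_0 by simp
    ultimately have d: "Suc n div p = Suc (n div p)" "m = Suc (n div p)"
      by simp_all
    have "absv (of_nat (Suc n) :: 'a) = absv (of_nat m :: 'a) / real p"
      unfolding m by (rule absv_of_nat_p_mult)
    moreover have "absv (fact m :: 'a) = absv (of_nat m :: 'a) * absv (fact (n div p) :: 'a)"
      unfolding d(2) by (simp only: fact_Suc absv_mult)
    ultimately show ?thesis
      unfolding fact Suc d(1) d(2)[symmetric] by (simp add: d(2))
  next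
    case False
    then have "Suc n div p = n div p"
      by (simp add: div_Suc dvd_eq_mod_eq_0)
    then show ?thesis
      unfolding fact Suc absv_of_nat_not_dvd[OF False] by simp
  qed
qed simp

lemma absv_fact_ge: "absv (fact n :: 'a) \<ge> 1 / real p ^ n"
proof (induction n rule: less_induct)
  case (less n)
  show ?case
  proof (cases "n = 0")
    case False
    have p: "real p \<ge> 1" "p > 1" using p_ge_3 by auto
    have "2 * (n div p) \<le> p * (n div p)"
      using p by (intro mult_right_mono) auto
    also have "\<dots> \<le> n" by simp
    finally have "n div p + n div p \<le> n" by simp
    then have "1 / real p ^ n \<le> 1 / real p ^ (n div p + n div p)"
      using p by (intro divide_left_mono power_increasing) auto
    also have "\<dots> = (1 / real p ^ (n div p)) / real p ^ (n div p)"
      by (simp add: power_add)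
    also have "\<dots> \<le> absv (fact (n div p) :: 'a) / real p ^ (n div p)"
      using False p by (intro divide_right_mono less.IH) auto
    finally show ?thesis
      by (simp only: absv_fact_div_p[symmetric])
  qed simp
qed

section \<open>Bounds for the Dwork exponential\<close>

definition r :: real where "r = 1 / real p ^ 2"

lemma r_pos: "r > 0" and r_less_1: "r < 1"
  using p_ge_3 by (auto simp: r_def one_less_power)

lemma absv_of_nat_le_r_iff: "absv (of_nat n :: 'a) \<le> r \<longleftrightarrow> p\<^sup>2 dvd n"
  unfolding r_def by (rule absv_of_nat_le_iff)

text \<open>
  By multiplicativity of the Gauss norm this is the Gauss norm of \<open>x(x+1)\<dots>(x+n-1)\<close> on
  the disc of radius \<open>r\<close>.
\<close>

definition weight :: "nat \<Rightarrow> real" where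
  "weight n = (\<Prod>j<n. max (absv (of_nat j :: 'a)) r)"

lemma weight_nonneg: "weight n \<ge> 0"
  unfolding weight_def using r_pos by (intro prod_nonneg) auto

lemma weight_Suc_fact: "weight (Suc n) * absv (fact (n div p\<^sup>2) :: 'a) = r * absv (fact n :: 'a)"
proof (induction n)
  case 0
  then show ?case using r_pos by (simp add: weight_def)
next
  case (Suc n)
  have fact: "absv (fact (Suc n) :: 'a) = absv (of_nat (Suc n) :: 'a) * absv (fact n :: 'a)" for n
    by (simp only: fact_Suc absv_mult)
  have weight: "weight (Suc (Suc n)) = weight (Suc n) * max (absv (of_nat (Suc n) :: 'a)) r"
    by (simp add: weight_def)
  show ?case
  proof (cases "p\<^sup>2 dvd Suc n")
    case True
    then obtain m where m: "Suc n = p\<^sup>2 * m" by (elim dvdE)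
    have "Suc n div p\<^sup>2 = Suc (n div p\<^sup>2)"
      using True by (simp add: div_Suc dvd_eq_mod_eq_0)
    moreover have "Suc n div p\<^sup>2 = m"
      unfolding m using p_gt_0 by simp
    ultimately have d: "Suc n div p\<^sup>2 = m" "m = Suc (n div p\<^sup>2)"
      by simp_all
    have absv_Suc: "absv (of_nat (Suc n) :: 'a) = r * absv (of_nat m :: 'a)"
      unfolding m by (simp add: absv_mult absv_power absv_p r_def power_divide)
    have fact_m: "absv (fact m :: 'a) = absv (of_nat m :: 'a) * absv (fact (n div p\<^sup>2) :: 'a)"
      unfolding d(2) by (rule fact)
    have "max (absv (of_nat (Suc n) :: 'a)) r = r"
      using True absv_of_nat_le_r_iff[of "Suc n"] by (simp only: max_def if_True)
    then have "weight (Suc (Suc n)) * absv (fact (Suc n div p\<^sup>2) :: 'a) =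
        (weight (Suc n) * absv (fact (n div p\<^sup>2) :: 'a)) * (r * absv (of_nat m :: 'a))"
      unfolding weight d(1) fact_m by (simp only: mult_ac)
    also have "\<dots> = r * absv (fact (Suc n) :: 'a)"
      unfolding Suc fact absv_Suc by simp
    finally show ?thesis .
  next
    case False
    then have d: "Suc n div p\<^sup>2 = n div p\<^sup>2"
      by (simp add: div_Suc dvd_eq_mod_eq_0)
    have "max (absv (of_nat (Suc n) :: 'a)) r = absv (of_nat (Suc n) :: 'a)"
      using False absv_of_nat_le_r_iff[of "Suc n"] by (simp add: max_def)
    then show ?thesis
      unfolding weight d fact using Suc by (simp add: mult_ac)
  qed
qed

lemma pochhammer_coeff_bound:
  "absv (Polynomial.coeff (pochhammer [:0, 1:] n :: 'a poly) s) * r ^ s \<le> weight n"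
proof (induction n arbitrary: s)
  case 0
  then show ?case using r_pos by (cases s) (auto simp: weight_def)
next
  case (Suc n)
  let ?P = "pochhammer [:0, 1:] n :: 'a poly"
  have P: "pochhammer [:0, 1:] (Suc n) = [:of_nat n, 1:] * ?P"
    by (simp add: pochhammer_Suc of_nat_poly)
  have weight: "weight (Suc n) = max (absv (of_nat n :: 'a)) r * weight n"
    by (simp add: weight_def)
  have n: "absv (of_nat n * Polynomial.coeff ?P s) * r ^ s \<le> weight (Suc n)" for s
    unfolding weight absv_mult mult.assoc
    using Suc[of s] r_pos by (intro mult_mono) auto
  show ?case
  proof (cases s)
    case 0
    then show ?thesis
      using n[of 0] unfolding P by simp
  next
    case (Suc s')
    have "absv (Polynomial.coeff ?P s') * r ^ s \<le> weight (Suc n)"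
      unfolding weight Suc using mult_mono[of r "max (absv (of_nat n :: 'a)) r", OF _ Suc.IH[of s']] r_pos
      by (simp add: mult_ac)
    then have "max (absv (of_nat n * Polynomial.coeff ?P s)) (absv (Polynomial.coeff ?P s')) * r ^ s \<le> weight (Suc n)"
      using n[of s] by (simp add: max_def)
    moreover have "absv (of_nat n * Polynomial.coeff ?P s + Polynomial.coeff ?P s') * r ^ s
        \<le> max (absv (of_nat n * Polynomial.coeff ?P s)) (absv (Polynomial.coeff ?P s')) * r ^ s"
      using r_pos by (intro mult_right_mono absv_add) auto
    ultimately show ?thesis
      unfolding P Suc coeff_linear_times_Suc by linarith
  qed
qed

definition B :: "nat \<Rightarrow> 'a" where
  "B n = dwork_exp p $ n"

definition rising :: "nat \<Rightarrow> 'a" where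
  "rising n = (\<Prod>i\<in>{1..p-1}. of_nat (n + i))"

lemma fact_add: "fact (n + m) = (\<Prod>i\<in>{1..m}. of_nat (n + i)) * (fact n :: 'a)"
  by (induction m) (auto simp: algebra_simps)

lemma fact_B_rec: "fact (n + p) * B (n + p) = fact (n + p - 1) * B (n + p - 1) + rising n * (fact n * B n)"
proof -
  obtain m where m: "n + p = Suc m"
    using p_gt_0 by (cases "n + p") auto
  have "\<not> Suc m < p" "Suc m - p = n"
    unfolding m[symmetric] by auto
  then have "of_nat (Suc m) * B (Suc m) = B m + B n"
    using dwork_exp_nth_Suc[OF p_gt_0, of m, where 'a='a] by (simp only: B_def if_False)
  then have "fact (Suc m) * B (Suc m) = fact m * B m + fact m * B n"
    by (simp only: fact_Suc mult.assoc mult.left_commute[of "of_nat (Suc m)"] distrib_left)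
  moreover have "fact m = rising n * fact n"
  proof -
    have "m = n + (p - 1)" using m p_gt_0 by simp
    then show ?thesis by (simp only: rising_def fact_add)
  qed
  ultimately show ?thesis
    unfolding m by (simp add: mult_ac)
qed

lemma fact_B_small: "n < p \<Longrightarrow> fact n * B n = 1"
proof (induction n)
  case 0
  then show ?case by (simp add: B_def dwork_exp_nth_0 p_gt_0)
next
  case (Suc n)
  have "of_nat (Suc n) * B (Suc n) = B n"
    using dwork_exp_nth_Suc[OF p_gt_0, of n, where 'a='a] Suc.prems by (simp add: B_def del: of_nat_Suc)
  moreover have "fact (Suc n) * B (Suc n) = fact n * (of_nat (Suc n) * B (Suc n))"
    by (simp only: fact_Suc mult_ac)
  ultimately show ?case
    using Suc by simp
qed

lemma absv_rising_not_dvd: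
  assumes "\<not> p dvd n"
  shows "absv (rising n) \<le> 1 / real p"
proof -
  let ?i = "p - n mod p"
  have "n mod p > 0"
    using assms by (simp add: dvd_eq_mod_eq_0)
  moreover have "n mod p < p" using p_gt_0 by simp
  ultimately have i: "?i \<in> {1..p-1}" by auto
  have "n + ?i = p * (n div p) + p"
    using \<open>n mod p < p\<close> mult_div_mod_eq[of p n] by linarith
  then have "p dvd n + ?i" by simp
  also have "n + ?i dvd (\<Prod>i\<in>{1..p-1}. n + i)"
    using i by (intro dvd_prodI) auto
  finally show ?thesis
    using absv_of_nat_le_iff[of "\<Prod>i\<in>{1..p-1}. n + i" 1] by (simp add: rising_def)
qed

lemma absv_rising_dvd:
  assumes "p dvd n"
  shows "absv (rising n + 1) \<le> 1 / real p"
proof -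
  have "[(\<Prod>i\<in>{1..p-1}. int n + int i) = (\<Prod>i\<in>{1..p-1}. int i)] (mod int p)"
  proof (rule cong_prod)
    fix i
    have "int p dvd int n + int i - int i" using assms by simp
    then show "[int n + int i = int i] (mod int p)"
      by (simp only: cong_iff_dvd_diff)
  qed
  also have "(\<Prod>i\<in>{1..p-1}. int i) = fact (p - 1)"
    by (simp add: fact_prod)
  also have "[fact (p - 1) = -1] (mod int p)"
    using wilson_theorem[OF prime_p] .
  finally have "int p ^ 1 dvd (\<Prod>i\<in>{1..p-1}. int n + int i) + 1"
    by (simp add: cong_iff_dvd_diff)
  then have "absv (of_int ((\<Prod>i\<in>{1..p-1}. int n + int i) + 1) :: 'a) \<le> 1 / real p ^ 1"
    by (simp only: absv_of_int_le_iff)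
  then show ?thesis by (simp add: rising_def)
qed

lemma fact_B_block:
  assumes "p dvd N" "\<And>i. i < p \<Longrightarrow> absv (fact (N + i) * B (N + i)) \<le> C" "i < p"
  shows "absv (fact (N + p + i) * B (N + p + i) - fact (N + p) * B (N + p)) \<le> C / real p"
    and "absv (fact (N + p + i) * B (N + p + i)) \<le> C"
proof -
  have C: "C \<ge> 0"
    using assms(2)[of 0] p_gt_0 absv_nonneg[of "fact (N + 0) * B (N + 0)"] by linarith
  have "rising N = of_nat (\<Prod>i\<in>{1..p-1}. N + i)"
    by (simp add: rising_def)
  then have "absv (rising N) \<le> 1"
    by (simp only: absv_of_nat_le_1)
  then have "absv (rising N * (fact N * B N)) \<le> 1 * C"
    using assms(2)[of 0] p_gt_0 by (intro absv_mult_le) auto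
  moreover have "absv (fact (N + p - 1) * B (N + p - 1)) \<le> C"
  proof -
    have "N + p - 1 = N + (p - 1)" using p_gt_0 by simp
    then show ?thesis
      using assms(2)[of "p - 1"] p_gt_0 by (simp only: diff_less)
  qed
  ultimately have 0: "absv (fact (N + p) * B (N + p)) \<le> C"
    unfolding fact_B_rec by (intro absv_add_le) auto
  show 1: "absv (fact (N + p + i) * B (N + p + i) - fact (N + p) * B (N + p)) \<le> C / real p"
    using assms(3)
  proof (induction i)
    case 0
    then show ?case using C by simp
  next
    case (Suc i)
    have ndvd: "\<not> p dvd N + Suc i"
      using Suc.prems nat_dvd_not_less[of "Suc i" p] by (simp only: dvd_add_right_iff[OF assms(1)]) simp
    have eq: "N + p + Suc i = (N + Suc i) + p" "N + p + i = (N + Suc i) + p - 1" by auto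
    have "absv (rising (N + Suc i) * (fact (N + Suc i) * B (N + Suc i))) \<le> 1 / real p * C"
      using assms(2) Suc.prems by (intro absv_mult_le absv_rising_not_dvd ndvd)
    then have "absv (fact (N + p + Suc i) * B (N + p + Suc i) - fact (N + p + i) * B (N + p + i)) \<le> C / real p"
      unfolding eq fact_B_rec[of "N + Suc i"] by simp
    then show ?case
      by (rule absv_diff_trans) (rule Suc.IH[OF Suc_lessD[OF Suc.prems]])
  qed
  have "C / real p \<le> C"
    using C p_ge_3 by (simp add: divide_le_eq mult_le_cancel_left1)
  with 1 0 show "absv (fact (N + p + i) * B (N + p + i)) \<le> C"
    using absv_add_le[of "fact (N + p + i) * B (N + p + i) - fact (N + p) * B (N + p)" C "fact (N + p) * B (N + p)"]
    by simp
qed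

lemma fact_B_two_blocks:
  assumes "p dvd N" "\<And>i. i < p \<Longrightarrow> absv (fact (N + i) * B (N + i)) \<le> C" "i < p"
  shows "absv (fact (N + 2 * p + i) * B (N + 2 * p + i)) \<le> C / real p"
proof -
  let ?u = "\<lambda>n. fact n * B n"
  have block2: "absv (?u (N + p + i)) \<le> C" if "i < p" for i
    by (rule fact_B_block(2)[OF assms(1)]) (use assms(2) that in auto)
  have dvd: "p dvd N + p" using assms(1) by simp
  have last: "N + p + (p - 1) = N + p + p - 1" using p_gt_0 by simp
  have "absv (?u (N + p + (p - 1)) - ?u (N + p)) \<le> C / real p"
    using p_gt_0 by (intro fact_B_block(1) assms) auto
  then have "absv (?u (N + p + p - 1) - ?u (N + p)) \<le> C / real p"
    unfolding last .
  moreover have "absv ((rising (N + p) + 1) * ?u (N + p)) \<le> 1 / real p * C"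
    using block2[of 0] p_gt_0 by (intro absv_mult_le absv_rising_dvd dvd) auto
  moreover have "?u (N + p + p) = (?u (N + p + p - 1) - ?u (N + p)) + (rising (N + p) + 1) * ?u (N + p)"
    unfolding fact_B_rec[of "N + p"] by (simp add: algebra_simps)
  ultimately have "absv (?u (N + p + p)) \<le> C / real p"
    using absv_add_le[of "?u (N + p + p - 1) - ?u (N + p)" "C / real p" "(rising (N + p) + 1) * ?u (N + p)"]
    by simp
  moreover have "absv (?u (N + p + p + i) - ?u (N + p + p)) \<le> C / real p"
    by (rule fact_B_block(1)[OF dvd block2 assms(3)])
  ultimately have "absv (?u (N + p + p + i)) \<le> C / real p"
    using absv_add_le[of "?u (N + p + p + i) - ?u (N + p + p)" "C / real p" "?u (N + p + p)"] by simp
  moreover have "N + p + p + i = N + 2 * p + i" by simp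
  ultimately show ?thesis by (simp only:)
qed

lemma absv_fact_B: "absv (fact n * B n) \<le> 1 / real p ^ (n div (2 * p))"
proof -
  have block: "absv (fact (2 * p * k + i) * B (2 * p * k + i)) \<le> 1 / real p ^ k" if "i < p" for k i
    using that
  proof (induction k arbitrary: i)
    case 0
    then show ?case by (simp add: fact_B_small)
  next
    case (Suc k)
    have "absv (fact (2 * p * k + 2 * p + i) * B (2 * p * k + 2 * p + i)) \<le> 1 / real p ^ k / real p"
      using Suc by (intro fact_B_two_blocks) auto
    moreover have "2 * p * k + 2 * p + i = 2 * p * Suc k + i" by simp
    ultimately show ?case by (simp only: power_Suc divide_divide_eq_left mult.commute[of "real p"])
  qed
  define k i where "k = n div (2 * p)" and "i = n mod (2 * p)"
  have n: "n = 2 * p * k + i" by (simp add: k_def i_def)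
  show ?thesis
  proof (cases "i < p")
    case True
    then show ?thesis using block[of i k] by (simp only: n[symmetric] k_def[symmetric])
  next
    case False
    have "i < 2 * p" using p_gt_0 by (simp add: i_def)
    then have "absv (fact (2 * p * k + p + (i - p)) * B (2 * p * k + p + (i - p))) \<le> 1 / real p ^ k"
      using False block by (intro fact_B_block(2)) auto
    moreover have "2 * p * k + p + (i - p) = n" using False n by simp
    ultimately show ?thesis by (simp only: k_def)
  qed
qed

end

context padic
begin

definition eps :: "nat \<Rightarrow> real" where
  "eps n = (let d = (n - 1) div (2 * p\<^sup>2) in 2 * real p ^ 2 * (real d + 1) * (1 / real p) ^ d)"

lemma eps_null: "eps \<longlonglongrightarrow> 0"
proof -
  have small: "norm (1 / real p) < 1" using p_ge_3 by simp
  have "(\<lambda>d. 2 * real p ^ 2 * (real d * (1 / real p) ^ d + (1 / real p) ^ d)) \<longlonglongrightarrow> 2 * real p ^ 2 * (0 + 0)"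
    using powser_times_n_limit_0[OF small] LIMSEQ_power_zero[OF small]
    by (intro tendsto_mult tendsto_add tendsto_const)
  then have lim: "(\<lambda>d. 2 * real p ^ 2 * (real d + 1) * (1 / real p) ^ d) \<longlonglongrightarrow> 0"
    by (simp add: algebra_simps)
  have "filterlim (\<lambda>n. (n - 1) div (2 * p\<^sup>2)) at_top sequentially"
    unfolding filterlim_at_top
  proof (intro allI)
    fix Z
    show "\<forall>\<^sub>F n in sequentially. Z \<le> (n - 1) div (2 * p\<^sup>2)"
      unfolding eventually_sequentially
    proof (intro exI allI impI)
      fix n assume "Z * (2 * p\<^sup>2) + 1 \<le> n"
      then have "Z * (2 * p\<^sup>2) \<le> n - 1" by simp
      then show "Z \<le> (n - 1) div (2 * p\<^sup>2)"
        using p_gt_0 by (simp add: less_eq_div_iff_mult_less_eq)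
    qed
  qed
  from filterlim_compose[OF lim this] show ?thesis
    by (simp add: eps_def[abs_def] Let_def)
qed

lemma B_weight_le_eps: "absv (B n) * weight n \<le> eps n"
proof (cases n)
  case 0
  have "real p ^ 2 \<ge> 1" using p_ge_3 by (intro one_le_power) auto
  then show ?thesis
    using 0 by (simp add: B_def dwork_exp_nth_0 p_gt_0 weight_def eps_def)
next
  case (Suc m)
  define q d k where "q = m div p\<^sup>2" and "d = m div (2 * p\<^sup>2)" and "k = Suc m div (2 * p)"
  have p1: "real p > 1" using p_ge_3 by simp
  have "d = q div 2"
    unfolding d_def q_def mult.commute[of 2 "p\<^sup>2"] by (rule div_mult2_eq)
  have "q * p\<^sup>2 \<le> Suc m"
    by (simp add: q_def le_SucI)
  then have "(q * p) * p div (2 * p) \<le> k"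
    unfolding k_def by (intro div_le_mono) (simp add: power2_eq_square mult.assoc)
  moreover have "(q * p) * p div (2 * p) = q * p div 2"
    using p_gt_0 by (intro div_mult_mult2) simp
  ultimately have "q * p div 2 \<le> k"
    by (simp only:)
  moreover have "q * 3 div 2 \<le> q * p div 2"
    using p_ge_3 by (intro div_le_mono mult_left_mono) auto
  moreover have "q + d \<le> q * 3 div 2"
    using \<open>d = q div 2\<close> by linarith
  ultimately have k: "q + d \<le> k" by linarith

  have fact_q: "absv (fact q :: 'a) > 0" "absv (fact m :: 'a) > 0" "absv (of_nat (Suc m) :: 'a) > 0"
    by (auto simp: less_le simp del: of_nat_Suc)
  have "absv (B n) * weight n * absv (fact q :: 'a) = r * (absv (B n) * absv (fact m :: 'a))"
    using weight_Suc_fact[of m] by (simp add: Suc q_def)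
  then have "absv (B n) * weight n * absv (fact q :: 'a) * absv (of_nat (Suc m) :: 'a)
      = r * absv (fact n * B n)"
    by (simp add: Suc absv_mult del: of_nat_Suc)
  also have "\<dots> \<le> 1 * (1 / real p ^ k)"
    using absv_fact_B[of n] r_pos r_less_1 unfolding Suc k_def by (intro mult_mono) auto
  finally have *: "absv (B n) * weight n * (absv (fact q :: 'a) * absv (of_nat (Suc m) :: 'a)) \<le> 1 / real p ^ k"
    by (simp only: mult.assoc mult_1_left)
  have "(1 / real p ^ q) * (1 / real (Suc m)) \<le> absv (fact q :: 'a) * absv (of_nat (Suc m) :: 'a)"
    by (intro mult_mono absv_fact_ge absv_of_nat_ge) auto
  then have "absv (B n) * weight n * ((1 / real p ^ q) * (1 / real (Suc m)))
      \<le> absv (B n) * weight n * (absv (fact q :: 'a) * absv (of_nat (Suc m) :: 'a))"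
    using weight_nonneg by (intro mult_left_mono) auto
  also note *
  finally have "absv (B n) * weight n * ((1 / real p ^ q) * (1 / real (Suc m))) \<le> 1 / real p ^ k" .
  moreover have "(1 / real p ^ q) * (1 / real (Suc m)) > 0"
    using p1 by simp
  ultimately have "absv (B n) * weight n \<le> (1 / real p ^ k) / ((1 / real p ^ q) * (1 / real (Suc m)))"
    by (simp only: pos_le_divide_eq)
  then have "absv (B n) * weight n \<le> real (Suc m) * real p ^ q / real p ^ k"
    by (simp add: mult.commute)
  also have "\<dots> \<le> real (Suc m) * real p ^ q / real p ^ (q + d)"
    using p1 k by (intro divide_left_mono power_increasing) auto
  also have "\<dots> = real (Suc m) * (1 / real p) ^ d"
    using p1 by (simp add: power_add field_simps)
  also have "real (Suc m) \<le> 2 * real p ^ 2 * (real d + 1)"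
  proof -
    have "m < 2 * p\<^sup>2 * (d + 1)"
      using dividend_less_div_times[of "2 * p\<^sup>2" m] p_gt_0 by (simp add: d_def algebra_simps)
    then have "real (Suc m) \<le> real (2 * p\<^sup>2 * (d + 1))"
      by (simp only: of_nat_le_iff)
    then show ?thesis by (simp add: algebra_simps)
  qed
  finally show ?thesis
    using p1 by (simp add: eps_def Let_def Suc d_def mult_right_mono)
qed

section \<open>The Taylor coefficients\<close>

definition summand :: "nat \<Rightarrow> nat \<Rightarrow> 'a" where
  "summand s n = B n * Polynomial.coeff (pochhammer [:0, 1:] n) s"

lemma summand_bound: "absv (summand s n) * r ^ s \<le> eps n"
proof -
  have "absv (B n) * (absv (Polynomial.coeff (pochhammer [:0, 1:] n :: 'a poly) s) * r ^ s) \<le> absv (B n) * weight n"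
    by (intro mult_left_mono pochhammer_coeff_bound) auto
  then show ?thesis
    using B_weight_le_eps[of n] by (simp add: summand_def absv_mult mult_ac)
qed

lemma eps_eventually_le:
  assumes "e > 0"
  obtains N where "\<And>n. n \<ge> N \<Longrightarrow> eps n \<le> e"
  using order_tendstoD(2)[OF eps_null assms] that
  by (auto simp: eventually_sequentially intro: less_imp_le)

definition A :: "nat \<Rightarrow> 'a" where
  "A s = (\<Sum>n. summand s n)"

lemma summand_sums: "summand s sums A s"
  unfolding A_def
proof (rule summable_sums, rule nonarch_summable)
  have "(\<lambda>n. eps n / r ^ s) \<longlonglongrightarrow> 0 / r ^ s"
    using r_pos by (intro tendsto_divide eps_null tendsto_const) auto
  then have lim: "(\<lambda>n. eps n / r ^ s) \<longlonglongrightarrow> 0" by simp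
  have "absv (summand s n) \<le> eps n / r ^ s" for n
    using summand_bound[of s n] r_pos by (simp add: pos_le_divide_eq)
  then show "(\<lambda>n. absv (summand s n)) \<longlonglongrightarrow> 0"
    by (intro tendsto_sandwich[OF _ _ tendsto_const lim]) auto
qed

lemma degree_pochhammer_pX: "degree (pochhammer [:0, 1:] n :: 'a poly) \<le> n"
proof (induction n)
  case (Suc n)
  have "pochhammer [:0, 1:] (Suc n) = pochhammer [:0, 1:] n * [:of_nat n, 1 :: 'a:]"
    by (simp add: pochhammer_Suc of_nat_poly)
  then have "degree (pochhammer [:0, 1:] (Suc n) :: 'a poly) \<le> degree (pochhammer [:0, 1:] n :: 'a poly) + degree [:of_nat n, 1 :: 'a:]"
    by (simp only: degree_mult_le)
  then show ?case using Suc by simp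
qed simp

lemma summand_eq_0: "n < s \<Longrightarrow> summand s n = 0"
  using degree_pochhammer_pX[of n] by (simp add: summand_def coeff_eq_0)

lemma A_tail_bound:
  assumes "\<And>n. n \<ge> N \<Longrightarrow> eps n \<le> e"
  shows "absv (A s - (\<Sum>n<N. summand s n)) * r ^ s \<le> e"
proof -
  have "absv (summand s n) \<le> e / r ^ s" if "n \<ge> N" for n
    using summand_bound[of s n] assms[OF that] r_pos by (simp add: pos_le_divide_eq)
  then have "absv (A s - (\<Sum>n<N. summand s n)) \<le> e / r ^ s"
    by (intro nonarch_sums_tail_le[OF summand_sums])
  then show ?thesis
    using r_pos by (simp add: pos_le_divide_eq)
qed

definition g_coeff :: "nat \<Rightarrow> 'a" where
  "g_coeff s = (-1) ^ s * A s"

lemma absv_g_coeff: "absv (g_coeff s) = absv (A s)"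
  by (simp add: g_coeff_def absv_mult absv_power)

lemma g_power_series: "nonarch_power_series g_coeff r"
proof
  show "r > 0" by (fact r_pos)
next
  show "(\<lambda>n. absv (g_coeff n) * r ^ n) \<longlonglongrightarrow> 0"
  proof (rule LIMSEQ_I)
    fix e :: real assume e: "e > 0"
    obtain N where N: "\<And>n. n \<ge> N \<Longrightarrow> eps n \<le> e / 2"
      using eps_eventually_le[of "e / 2"] e by auto
    have "absv (g_coeff n) * r ^ n < e" if "n \<ge> N" for n
    proof -
      have "(\<Sum>i<n. summand n i) = 0"
        by (intro sum.neutral) (auto simp: summand_eq_0)
      then show ?thesis
        using A_tail_bound[of n "e / 2" n] N that e by (simp add: absv_g_coeff)
    qed
    then show "\<exists>no. \<forall>n\<ge>no. norm (absv (g_coeff n) * r ^ n - 0) < e"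
      using r_pos by (intro exI[of _ N]) (simp add: abs_mult)
  qed
qed

sublocale G: nonarch_power_series g_coeff r
  by (fact g_power_series)

lemma psum_pochhammer:
  assumes y: "absv y \<le> r"
  shows "(\<lambda>n. B n * pochhammer (- y) n) sums G.psum y"
proof -
  define S H where "S N = (\<Sum>s<N. g_coeff s * y ^ s)" and "H N = (\<Sum>n<N. B n * pochhammer (- y) n)" for N
  have eq: "S N - H N = (\<Sum>s<N. (A s - (\<Sum>n<N. summand s n)) * (- y) ^ s)" for N
  proof -
    have "B n * pochhammer (- y) n = (\<Sum>s<N. summand s n * (- y) ^ s)" if "n < N" for n
    proof -
      have "pochhammer (- y) n = (\<Sum>s\<le>degree (pochhammer [:0, 1:] n :: 'a poly). Polynomial.coeff (pochhammer [:0, 1:] n) s * (- y) ^ s)"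
        using poly_altdef[of "pochhammer [:0, 1:] n" "- y"] by (simp only: poly_pochhammer_pX)
      also have "\<dots> = (\<Sum>s<N. Polynomial.coeff (pochhammer [:0, 1:] n) s * (- y) ^ s)"
        using degree_pochhammer_pX[of n] that
        by (intro sum.mono_neutral_left) (auto simp: coeff_eq_0 not_le)
      finally show ?thesis
        by (simp add: summand_def sum_distrib_left mult_ac)
    qed
    then have "H N = (\<Sum>n<N. \<Sum>s<N. summand s n * (- y) ^ s)"
      by (simp add: H_def)
    also have "\<dots> = (\<Sum>s<N. (\<Sum>n<N. summand s n) * (- y) ^ s)"
      unfolding sum_distrib_right by (rule sum.swap)
    finally have "H N = (\<Sum>s<N. (\<Sum>n<N. summand s n) * (- y) ^ s)" .
    moreover have "S N = (\<Sum>s<N. A s * (- y) ^ s)"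
      unfolding S_def g_coeff_def by (intro sum.cong) (auto simp: power_minus[of y])
    ultimately show ?thesis
      by (simp only: left_diff_distrib sum_subtractf)
  qed
  have "(\<lambda>N. S N - H N) \<longlonglongrightarrow> 0"
  proof (rule metric_LIMSEQ_I)
    fix e :: real assume e: "e > 0"
    obtain N where N: "\<And>n. n \<ge> N \<Longrightarrow> eps n \<le> e / 2"
      using eps_eventually_le[of "e / 2"] e by auto
    have "absv (S M - H M) \<le> e / 2" if "M \<ge> N" for M
      unfolding eq
    proof (intro absv_sum_le)
      fix s
      have "absv ((A s - (\<Sum>n<M. summand s n)) * (- y) ^ s) \<le> absv (A s - (\<Sum>n<M. summand s n)) * r ^ s"
        unfolding absv_mult using y by (intro mult_left_mono absv_power_le) auto
      also have "\<dots> \<le> e / 2"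
        using N that by (intro A_tail_bound) auto
      finally show "absv ((A s - (\<Sum>n<M. summand s n)) * (- y) ^ s) \<le> e / 2" .
    qed (use e in simp)
    then show "\<exists>no. \<forall>n\<ge>no. dist (S n - H n) 0 < e"
      using e by (intro exI[of _ N]) (force simp: dist_absv)
  qed
  moreover have "S \<longlonglongrightarrow> G.psum y"
    using G.psum_sums[OF y] unfolding sums_def S_def .
  ultimately have "(\<lambda>N. S N - (S N - H N)) \<longlonglongrightarrow> G.psum y - 0"
    by (intro tendsto_diff)
  then show ?thesis
    by (simp add: sums_def H_def)
qed

section \<open>Values at natural numbers\<close>

primrec gam :: "nat \<Rightarrow> 'a" where
  "gam 0 = 1"
| "gam (Suc n) = - (if p dvd n then 1 else of_nat n) * gam n"

definition E :: "'a fps" where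
  "E = fps_exp (-1) * dwork_exp p"

lemma fps_deriv_E: "fps_deriv E = fps_X ^ (p - 1) * E"
  by (simp add: E_def fps_deriv_dwork_exp[OF p_gt_0] algebra_simps flip: fps_const_neg)

lemma E_nth_0: "E $ 0 = 1"
  by (simp add: E_def dwork_exp_nth_0 p_gt_0)

lemma E_nth_p: "of_nat (n + p) * E $ (n + p) = E $ n"
proof -
  have "fps_deriv E $ (n + p - 1) = (fps_X ^ (p - 1) * E) $ (n + p - 1)"
    by (simp only: fps_deriv_E)
  then show ?thesis
    using p_gt_0 by (simp add: fps_X_power_mult_nth)
qed

lemma gam_block:
  assumes "p dvd n" "i < p"
  shows "gam (n + Suc i) * fact n = gam n * (-1) ^ Suc i * fact (n + i)"
  using assms(2)
proof (induction i)
  case 0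
  then show ?case using assms(1) by simp
next
  case (Suc i)
  have ndvd: "\<not> p dvd n + Suc i"
    using Suc.prems nat_dvd_not_less[of "Suc i" p] by (simp only: dvd_add_right_iff[OF assms(1)]) simp
  have "gam (n + Suc (Suc i)) = - of_nat (n + Suc i) * gam (n + Suc i)"
    using ndvd by (simp only: add_Suc_right[of n "Suc i"] gam.simps if_False)
  moreover have "fact (n + Suc i) = of_nat (n + Suc i) * (fact (n + i) :: 'a)"
    by (simp only: add_Suc_right fact_Suc)
  moreover have "gam (n + Suc i) * fact n = gam n * (-1) ^ Suc i * fact (n + i)"
    using Suc by simp
  ultimately show ?case
    by (simp only: power_Suc[of _ "Suc i"] mult_minus_left mult_1_left mult.assoc) (simp only: mult_ac mult_minus_right)
qed

lemma gam_p_mult: "gam (p * l) = (-1) ^ (p * l) * fact (p * l) * E $ (p * l)"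
proof (induction l)
  case 0
  then show ?case by (simp add: E_nth_0)
next
  case (Suc l)
  define n where "n = p * l"
  obtain p' where p': "p = Suc p'" using p_gt_0 by (cases p) auto
  have "gam (n + Suc p') * fact n = gam n * (-1) ^ Suc p' * fact (n + p')"
    by (rule gam_block) (simp_all add: n_def p' del: mult_Suc)
  then have "gam (n + p) * fact n = gam n * (-1) ^ p * fact (n + p')"
    by (simp only: p'[symmetric])
  also have "gam n = (-1) ^ n * fact n * E $ n"
    using Suc by (simp only: n_def)
  also have "E $ n = of_nat (n + p) * E $ (n + p)"
    by (rule E_nth_p[symmetric])
  also have "(-1) ^ n * fact n * (of_nat (n + p) * E $ (n + p)) * (-1) ^ p * fact (n + p') =
      ((-1) ^ (n + p) * (of_nat (n + p) * fact (n + p')) * E $ (n + p)) * fact n"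
    by (simp only: power_add mult_ac)
  also have "of_nat (n + p) * fact (n + p') = (fact (n + p) :: 'a)"
    by (simp add: p' del: of_nat_add of_nat_Suc)
  finally have "gam (n + p) = (-1) ^ (n + p) * fact (n + p) * E $ (n + p)"
    by simp
  then show ?case by (simp add: n_def add.commute)
qed

lemma pochhammer_minus_of_nat:
  assumes "k \<le> m"
  shows "pochhammer (- of_nat m) k = (-1) ^ k * fact m / (fact (m - k) :: 'a)"
proof -
  have "(of_nat (m choose k) :: 'a) = (-1) ^ k * pochhammer (- of_nat m) k / fact k"
    by (simp only: binomial_gbinomial gbinomial_pochhammer)
  moreover have "(of_nat (m choose k) :: 'a) = fact m / (fact k * fact (m - k))"
    by (rule binomial_fact[OF assms])
  ultimately have "(-1) ^ k * pochhammer (- of_nat m) k = (fact m / fact (m - k) :: 'a)"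
    by (simp add: field_simps)
  then have "(-1) ^ k * ((-1) ^ k * pochhammer (- of_nat m) k) = (-1) ^ k * (fact m / fact (m - k) :: 'a)"
    by simp
  then show ?thesis
    by (simp flip: mult.assoc power_mult_distrib)
qed

lemma sum_B_pochhammer: "(\<Sum>n\<le>m. B n * pochhammer (- of_nat m) n) = (-1) ^ m * fact m * E $ m"
proof -
  have "E $ m = (dwork_exp p * fps_exp (-1)) $ m"
    by (simp add: E_def mult.commute)
  also have "\<dots> = (\<Sum>n\<le>m. B n * ((-1) ^ (m - n) / fact (m - n)))"
    by (simp add: fps_mult_nth B_def atMost_atLeast0)
  finally have "(-1) ^ m * fact m * E $ m = (\<Sum>n\<le>m. B n * ((-1) ^ m * (-1) ^ (m - n) * fact m / fact (m - n)))"
    by (simp add: sum_distrib_left mult_ac)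
  also have "\<dots> = (\<Sum>n\<le>m. B n * pochhammer (- of_nat m) n)"
  proof (intro sum.cong refl)
    fix n assume "n \<in> {..m}"
    then have "m + (m - n) = n + 2 * (m - n)" "n \<le> m" by auto
    then have "(-1) ^ m * (-1) ^ (m - n) = ((-1) ^ n :: 'a)"
      by (metis mult.right_neutral power_add power_minus1_even)
    then show "B n * ((-1) ^ m * (-1) ^ (m - n) * fact m / fact (m - n)) = B n * pochhammer (- of_nat m) n"
      using \<open>n \<le> m\<close> by (simp add: pochhammer_minus_of_nat)
  qed
  finally show ?thesis ..
qed

lemma psum_of_nat:
  assumes "p\<^sup>2 dvd m"
  shows "G.psum (of_nat m) = gam m"
proof -
  have "absv (of_nat m :: 'a) \<le> r"
    using assms absv_of_nat_le_r_iff by simp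
  then have "(\<lambda>n. B n * pochhammer (- of_nat m) n) sums G.psum (of_nat m)"
    by (rule psum_pochhammer)
  moreover have "(\<lambda>n. B n * pochhammer (- of_nat m) n) sums (\<Sum>n\<le>m. B n * pochhammer (- of_nat m) n)"
    by (rule sums_finite) (auto simp: pochhammer_of_nat_eq_0_lemma)
  ultimately have "G.psum (of_nat m) = (-1) ^ m * fact m * E $ m"
    unfolding sum_B_pochhammer by (rule sums_unique2)
  moreover have "p dvd m"
    using assms by (auto simp: power2_eq_square dest: dvd_mult_left)
  ultimately show ?thesis
    using gam_p_mult[of "m div p"] by simp
qed

end

section \<open>The p-adic integers and the Gamma function\<close>

context padic
begin

lemma absv_of_int_not_dvd:
  assumes "\<not> int p dvd z"
  shows "absv (of_int z :: 'a) = 1"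
  using assms absv_of_nat_not_dvd[of "nat \<bar>z\<bar>"] by (cases z rule: int_cases2) auto

lemma power_p_small:
  assumes "e > 0"
  obtains k where "1 / real p ^ k < e"
  using real_arch_pow_inv[of e "1 / real p"] assms p_ge_3 that by (auto simp: power_divide)

lemma closed_Zp: "closed (Zp :: 'a set)"
proof -
  have "(Zp :: 'a set) = closure \<rat> \<inter> cball 0 1"
    by (auto simp: Zp_def Qp_def dist_absv)
  moreover have "closed (closure \<rat> \<inter> cball (0::'a) 1)"
    by (intro closed_Int closed_closure closed_cball)
  ultimately show ?thesis by metis
qed

lemma of_int_in_Zp: "of_int z \<in> (Zp :: 'a set)"
  using closure_subset[of \<rat>] by (auto simp: Zp_def Qp_def absv_of_int_le_1)

lemma of_nat_in_Zp: "of_nat n \<in> (Zp :: 'a set)"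
  using of_int_in_Zp[of "int n"] by simp

lemma rat_approx_nat:
  assumes "x \<in> \<rat>" "absv (x :: 'a) \<le> 1"
  obtains n :: nat where "absv (of_nat n - x) \<le> 1 / real p ^ k"
proof -
  obtain a b where x: "x = of_int a / of_int b" and ab: "b > 0" "coprime a b"
    using assms(1) by (elim Rats_cases') auto
  have "\<not> int p dvd b"
  proof
    assume b: "int p dvd b"
    have a: "\<not> int p dvd a"
    proof
      assume "int p dvd a"
      then have "int p dvd 1"
        using b ab(2) coprime_common_divisor by blast
      then show False using p_ge_3 by simp
    qed
    have "absv (of_int b :: 'a) \<le> 1 / real p ^ 1"
      using b unfolding absv_of_int_le_iff by simp
    then have "absv (of_int b :: 'a) < 1"
      using p_ge_3 by (simp add: divide_less_eq order_le_less_trans)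
    moreover have "absv (of_int b :: 'a) > 0"
      using ab(1) by (simp add: less_le)
    ultimately show False
      using assms(2) by (simp add: x absv_divide absv_of_int_not_dvd[OF a])
  qed
  then have absv_b: "absv (of_int b :: 'a) = 1"
    by (rule absv_of_int_not_dvd)
  have "coprime (int p ^ k) b"
    using \<open>\<not> int p dvd b\<close> prime_p by (simp add: prime_imp_coprime)
  then obtain c where c: "[b * c = 1] (mod int p ^ k)"
    using cong_solve_coprime_int[of b "int p ^ k"] by (auto simp: coprime_commute)
  define n where "n = nat (a * c mod int p ^ k)"
  have "int n = a * c mod int p ^ k"
    using p_gt_0 by (simp add: n_def)
  then have "[int n = a * c] (mod int p ^ k)"
    by (simp add: cong_def)
  then have "[b * int n = b * (a * c)] (mod int p ^ k)"
    by (rule cong_scalar_left)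
  also have "b * (a * c) = a * (b * c)" by simp
  also have "[a * (b * c) = a * 1] (mod int p ^ k)"
    by (rule cong_scalar_left[OF c])
  finally have "int p ^ k dvd b * int n - a"
    by (simp add: cong_iff_dvd_diff)
  then have "absv (of_int (b * int n - a) :: 'a) \<le> 1 / real p ^ k"
    by (simp only: absv_of_int_le_iff)
  moreover have "of_nat n - x = of_int (b * int n - a) / of_int b"
    using ab(1) by (simp add: x field_simps)
  ultimately show ?thesis
    using that[of n] by (simp add: absv_divide absv_b)
qed

lemma Zp_eq_closure: "(Zp :: 'a set) = closure (range of_nat)"
proof
  show "closure (range of_nat) \<subseteq> (Zp :: 'a set)"
    by (rule closure_minimal) (auto simp: of_nat_in_Zp closed_Zp)
  show "Zp \<subseteq> closure (range of_nat :: 'a set)"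
  proof
    fix x :: 'a assume x: "x \<in> Zp"
    show "x \<in> closure (range of_nat)"
      unfolding closure_approachable
    proof (intro allI impI)
      fix e :: real assume e: "e > 0"
      obtain k where k: "1 / real p ^ k < e"
        using power_p_small[OF e] .
      have "x \<in> closure \<rat>" using x by (simp add: Zp_def Qp_def)
      then obtain y where y: "y \<in> \<rat>" "dist y x < min e 1"
        unfolding closure_approachable using e by (metis min_less_iff_conj zero_less_one)
      have "absv y \<le> 1"
        using absv_add_le[of "y - x" 1 x] x y(2) by (simp add: Zp_def dist_absv)
      from rat_approx_nat[OF y(1) this] obtain n where n: "absv (of_nat n - y) \<le> 1 / real p ^ k" .
      have "absv (of_nat n - x) < e"
        using absv_add[of "of_nat n - y" "y - x"] n k y(2) by (simp add: dist_absv max_def split: if_splits)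
      then show "\<exists>z\<in>range of_nat. dist z x < e"
        by (auto simp: dist_absv)
    qed
  qed
qed

lemma Zp_nat_limit:
  assumes "x \<in> (Zp :: 'a set)"
  obtains f :: "nat \<Rightarrow> nat" where "(\<lambda>k. of_nat (f k)) \<longlonglongrightarrow> x"
proof -
  obtain h where h: "\<And>k. h k \<in> range of_nat" "h \<longlonglongrightarrow> x"
    using assms unfolding Zp_eq_closure closure_sequential by blast
  then obtain f where "\<And>k. h k = of_nat (f k)"
    unfolding image_iff by metis
  then have "h = (\<lambda>k. of_nat (f k))" by auto
  then show ?thesis using that[of f] h(2) by simp
qed

lemma Zp_add:
  assumes "x \<in> (Zp :: 'a set)" "y \<in> Zp"
  shows "x + y \<in> Zp"
proof -
  obtain f g :: "nat \<Rightarrow> nat" where "(\<lambda>k. of_nat (f k)) \<longlonglongrightarrow> x" "(\<lambda>k. of_nat (g k)) \<longlonglongrightarrow> y"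
    using assms Zp_nat_limit by metis
  then have "(\<lambda>k. of_nat (f k) + of_nat (g k)) \<longlonglongrightarrow> x + y"
    by (rule tendsto_add)
  then show ?thesis
    using closed_Zp by (rule Lim_in_closed_set[rotated 3]) (simp_all add: of_nat_in_Zp flip: of_nat_add)
qed

lemma gam_in_Zp: "gam n \<in> Zp"
proof -
  have "gam n \<in> \<int>"
    by (induction n) auto
  then show ?thesis
    by (auto elim!: Ints_cases simp: of_int_in_Zp)
qed

lemma absv_gam: "absv (gam n) = 1"
  by (induction n) (auto simp: absv_mult absv_of_nat_not_dvd)

lemma gam_lipschitz:
  obtains L where "L > 0"
    "\<And>m n. absv (of_nat m - of_nat n :: 'a) \<le> r \<Longrightarrow> absv (gam m - gam n) \<le> L * absv (of_nat m - of_nat n :: 'a)"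
proof -
  obtain K where K: "K > 0"
    "\<And>x y. absv x \<le> r \<Longrightarrow> absv y \<le> r \<Longrightarrow> absv (G.psum y - G.psum x) \<le> K * absv (y - x)"
    using G.psum_lipschitz by blast
  define L where "L = max K 1"
  have shift: "absv (gam (M + j) - gam (N + j)) \<le> L * absv (of_nat M - of_nat N :: 'a)"
    if MN: "p\<^sup>2 dvd M" "p\<^sup>2 dvd N" for M N j
  proof (induction j)
    case 0
    have "absv (gam M - gam N) \<le> K * absv (of_nat M - of_nat N :: 'a)"
      using K(2)[of "of_nat N" "of_nat M"] MN absv_of_nat_le_r_iff by (simp add: psum_of_nat)
    also have "\<dots> \<le> L * absv (of_nat M - of_nat N :: 'a)"
      by (intro mult_right_mono) (auto simp: L_def)
    finally show ?case by simp
  next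
    case (Suc j)
    have "p dvd M" "p dvd N"
      using MN by (auto simp: power2_eq_square dest: dvd_mult_left)
    then have dvd: "p dvd M + j \<longleftrightarrow> p dvd j" "p dvd N + j \<longleftrightarrow> p dvd j"
      by (simp_all add: dvd_add_right_iff)
    show ?case
    proof (cases "p dvd j")
      case True
      then have "gam (M + Suc j) - gam (N + Suc j) = - (gam (M + j) - gam (N + j))"
        using dvd by simp
      then show ?thesis using Suc by (simp only: absv_minus)
    next
      case False
      then have "gam (M + Suc j) - gam (N + Suc j) =
          - (of_nat (M + j) * (gam (M + j) - gam (N + j)) + (of_nat M - of_nat N) * gam (N + j))"
        using dvd by (simp add: algebra_simps)
      moreover have "absv (of_nat (M + j) * (gam (M + j) - gam (N + j))) \<le> 1 * (L * absv (of_nat M - of_nat N :: 'a))"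
        by (intro absv_mult_le absv_of_nat_le_1 Suc)
      moreover have "absv ((of_nat M - of_nat N) * gam (N + j)) \<le> L * absv (of_nat M - of_nat N :: 'a)"
        using mult_right_mono[of 1 L "absv (of_nat M - of_nat N :: 'a)"]
        by (simp add: absv_mult absv_gam L_def)
      ultimately show ?thesis
        by (simp only: absv_minus mult_1_left absv_add_le)
    qed
  qed
  have "absv (gam m - gam n) \<le> L * absv (of_nat m - of_nat n :: 'a)" if "absv (of_nat m - of_nat n :: 'a) \<le> r" for m n
  proof -
    have "absv (of_int (int m - int n) :: 'a) \<le> 1 / real p ^ 2"
      using that by (simp add: r_def)
    then have "int p ^ 2 dvd int m - int n"
      by (simp only: absv_of_int_le_iff)
    then have "int m mod int (p\<^sup>2) = int n mod int (p\<^sup>2)"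
      by (simp add: mod_eq_dvd_iff)
    then have "m mod p\<^sup>2 = n mod p\<^sup>2"
      by (simp only: of_nat_mod[symmetric] of_nat_eq_iff)
    define j where "j = n mod p\<^sup>2"
    have m: "m = p\<^sup>2 * (m div p\<^sup>2) + j"
      unfolding j_def \<open>m mod p\<^sup>2 = n mod p\<^sup>2\<close>[symmetric] by simp
    have n: "n = p\<^sup>2 * (n div p\<^sup>2) + j"
      by (simp add: j_def)
    have "of_nat m - of_nat n = (of_nat (p\<^sup>2 * (m div p\<^sup>2)) - of_nat (p\<^sup>2 * (n div p\<^sup>2)) :: 'a)"
      by (subst m, subst n) (simp only: of_nat_add add_diff_cancel_right)
    then show ?thesis
      using shift[of "p\<^sup>2 * (m div p\<^sup>2)" "p\<^sup>2 * (n div p\<^sup>2)" j] m n by simp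
  qed
  with that[of L] show ?thesis by (simp add: L_def)
qed

lemma continuous_gam_extension:
  obtains g :: "'a \<Rightarrow> 'a" where "continuous_on Zp g" "\<And>n. g (of_nat n) = gam n"
proof -
  define g0 where "g0 x = gam (inv_into UNIV of_nat x)" for x :: 'a
  have g0: "g0 (of_nat n) = gam n" for n
    by (simp add: g0_def inv_into_f_f[OF inj_of_nat])
  obtain L where L: "L > 0"
    "\<And>m n. absv (of_nat m - of_nat n :: 'a) \<le> r \<Longrightarrow> absv (gam m - gam n) \<le> L * absv (of_nat m - of_nat n :: 'a)"
    using gam_lipschitz by blast
  have "uniformly_continuous_on (range of_nat) g0"
    unfolding uniformly_continuous_on_def
  proof (intro allI impI)
    fix e :: real assume e: "e > 0"
    have "dist (gam m) (gam n) < e" if "dist (of_nat m) (of_nat n :: 'a) < min r (e / L)" for m n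
    proof -
      have lt: "absv (of_nat m - of_nat n :: 'a) < r" "absv (of_nat m - of_nat n :: 'a) < e / L"
        using that by (simp_all add: dist_absv)
      then have "L * absv (of_nat m - of_nat n :: 'a) < e"
        using L(1) by (simp add: pos_less_divide_eq mult.commute)
      then show ?thesis
        using L(2)[of m n] lt by (simp add: dist_absv)
    qed
    then show "\<exists>d>0. \<forall>x\<in>range of_nat. \<forall>x'\<in>range of_nat. dist x' x < d \<longrightarrow> dist (g0 x') (g0 x) < e"
      using e L(1) r_pos by (intro exI[of _ "min r (e / L)"]) (auto simp: g0)
  qed
  then show ?thesis
  proof (rule uniformly_continuous_on_extension_on_closure)
    fix g assume g: "uniformly_continuous_on (closure (range of_nat)) g" "\<And>x. x \<in> range of_nat \<Longrightarrow> g0 x = g x"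
    have "continuous_on Zp g"
      unfolding Zp_eq_closure by (rule uniformly_continuous_imp_continuous[OF g(1)])
    moreover have "g (of_nat n) = gam n" for n
      using g(2)[of "of_nat n"] g0[of n] by simp
    ultimately show ?thesis by (rule that)
  qed
qed

lemma continuous_Zp_limit:
  fixes g :: "'a \<Rightarrow> 'a"
  assumes "continuous_on Zp g" "x \<in> Zp" "(\<lambda>k. of_nat (f k)) \<longlonglongrightarrow> x"
  shows "(\<lambda>k. g (of_nat (f k))) \<longlonglongrightarrow> g x"
  by (rule continuous_on_tendsto_compose[OF assms(1,3,2)]) (simp add: of_nat_in_Zp)

lemma is_Gamma_p_iff:
  "is_Gamma_p g \<longleftrightarrow> continuous_on Zp g \<and> (\<forall>n. g (of_nat n) = gam n)"
proof
  assume g: "is_Gamma_p g"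
  have "g (of_nat n) = gam n" for n
  proof (induction n)
    case 0
    then show ?case using g by (simp add: is_Gamma_p_def)
  next
    case (Suc n)
    have "g (of_nat n + 1) = - (if p dvd n then 1 else of_nat n) * g (of_nat n)"
      using g of_nat_in_Zp[of n] absv_of_nat_less_1_iff[of n] absv_of_nat_not_dvd[of n]
      unfolding is_Gamma_p_def by (cases "p dvd n") auto
    then show ?case using Suc by (simp add: add.commute)
  qed
  then show "continuous_on Zp g \<and> (\<forall>n. g (of_nat n) = gam n)"
    using g by (simp add: is_Gamma_p_def)
next
  assume "continuous_on Zp g \<and> (\<forall>n. g (of_nat n) = gam n)"
  then have cont: "continuous_on Zp g" and g: "g (of_nat n) = gam n" for n
    by auto
  have approx: "\<exists>f. (\<lambda>k. of_nat (f k)) \<longlonglongrightarrow> x \<and> (\<lambda>k. gam (f k)) \<longlonglongrightarrow> g x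
      \<and> (\<lambda>k. gam (Suc (f k))) \<longlonglongrightarrow> g (x + 1)" if x: "x \<in> Zp" for x
  proof -
    obtain f where f: "(\<lambda>k. of_nat (f k)) \<longlonglongrightarrow> x"
      using Zp_nat_limit[OF x] .
    have "(\<lambda>k. of_nat (f k) + 1) \<longlonglongrightarrow> x + 1"
      by (intro tendsto_add f tendsto_const)
    then have Suc: "(\<lambda>k. of_nat (Suc (f k))) \<longlonglongrightarrow> x + 1"
      by (simp add: add.commute)
    have "x + 1 \<in> Zp"
      using Zp_add[OF x, of 1] of_nat_in_Zp[of 1] by simp
    from continuous_Zp_limit[OF cont this Suc] continuous_Zp_limit[OF cont x f] f show ?thesis
      by (intro exI[of _ f]) (simp only: g)
  qed
  show "is_Gamma_p g"
    unfolding is_Gamma_p_def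
  proof (intro conjI ballI impI)
    show "continuous_on Zp g" by (fact cont)
    show "g 0 = 1" using g[of 0] by simp
  next
    fix x :: 'a assume x: "x \<in> Zp"
    from approx[OF x] obtain f where f: "(\<lambda>k. of_nat (f k)) \<longlonglongrightarrow> x" "(\<lambda>k. gam (f k)) \<longlonglongrightarrow> g x"
      "(\<lambda>k. gam (Suc (f k))) \<longlonglongrightarrow> g (x + 1)"
      by blast
    show "g x \<in> Zp"
      by (rule Lim_in_closed_set[OF closed_Zp _ _ f(2)]) (simp_all add: gam_in_Zp)
    show "absv (g x) = 1"
      using tendsto_absv[OF f(2)] by (simp add: absv_gam LIMSEQ_const_iff)
    have absv_lim: "(\<lambda>k. absv (of_nat (f k) :: 'a)) \<longlonglongrightarrow> absv x"
      by (rule tendsto_absv[OF f(1)])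
    show "g (x + 1) = - x * g x" if "absv x = 1"
    proof -
      have "eventually (\<lambda>k. absv (of_nat (f k) :: 'a) > 1 / real p) sequentially"
        using order_tendstoD(1)[OF absv_lim, of "1 / real p"] that p_ge_3 by simp
      then have "eventually (\<lambda>k. gam (Suc (f k)) = - of_nat (f k) * gam (f k)) sequentially"
      proof eventually_elim
        case (elim k)
        then have "\<not> p dvd f k"
          using absv_of_nat_le_iff[of "f k" 1] by auto
        then show ?case by simp
      qed
      with f(3) have "(\<lambda>k. - of_nat (f k) * gam (f k)) \<longlonglongrightarrow> g (x + 1)"
        by (rule Lim_transform_eventually)
      moreover have "(\<lambda>k. - of_nat (f k) * gam (f k)) \<longlonglongrightarrow> - x * g x"
        by (intro tendsto_mult tendsto_minus f)
      ultimately show ?thesis by (rule LIMSEQ_unique)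
    qed
    show "g (x + 1) = - g x" if "absv x < 1"
    proof -
      have "eventually (\<lambda>k. absv (of_nat (f k) :: 'a) < 1) sequentially"
        using order_tendstoD(2)[OF absv_lim that] .
      then have "eventually (\<lambda>k. gam (Suc (f k)) = - gam (f k)) sequentially"
        by eventually_elim (simp add: absv_of_nat_less_1_iff)
      with f(3) have "(\<lambda>k. - gam (f k)) \<longlonglongrightarrow> g (x + 1)"
        by (rule Lim_transform_eventually)
      moreover have "(\<lambda>k. - gam (f k)) \<longlonglongrightarrow> - g x"
        by (intro tendsto_minus f)
      ultimately show ?thesis by (rule LIMSEQ_unique)
    qed
  qed
qed

lemma is_Gamma_p_Gamma_p: "is_Gamma_p (Gamma_p :: 'a \<Rightarrow> 'a)"
proof -
  have "\<exists>!g::'a \<Rightarrow> 'a. is_Gamma_p g \<and> (\<forall>x. x \<notin> Zp \<longrightarrow> g x = 0)"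
  proof (rule ex_ex1I)
    obtain g :: "'a \<Rightarrow> 'a" where g: "continuous_on Zp g" "\<And>n. g (of_nat n) = gam n"
      using continuous_gam_extension by blast
    have "continuous_on Zp (\<lambda>x. if x \<in> Zp then g x else 0)"
      using g(1) by (simp cong: continuous_on_cong)
    then show "\<exists>g::'a \<Rightarrow> 'a. is_Gamma_p g \<and> (\<forall>x. x \<notin> Zp \<longrightarrow> g x = 0)"
      using g(2) by (intro exI[of _ "\<lambda>x. if x \<in> Zp then g x else 0"]) (auto simp: is_Gamma_p_iff of_nat_in_Zp)
  next
    fix g h :: "'a \<Rightarrow> 'a"
    assume g: "is_Gamma_p g \<and> (\<forall>x. x \<notin> Zp \<longrightarrow> g x = 0)" and h: "is_Gamma_p h \<and> (\<forall>x. x \<notin> Zp \<longrightarrow> h x = 0)"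
    show "g = h"
    proof
      fix x :: 'a
      show "g x = h x"
      proof (cases "x \<in> Zp")
        case True
        obtain f where f: "(\<lambda>k. of_nat (f k)) \<longlonglongrightarrow> x"
          using Zp_nat_limit[OF True] .
        have "(\<lambda>k. gam (f k)) \<longlonglongrightarrow> g x" "(\<lambda>k. gam (f k)) \<longlonglongrightarrow> h x"
          using g h continuous_Zp_limit[OF _ True f, of g] continuous_Zp_limit[OF _ True f, of h]
          unfolding is_Gamma_p_iff by simp_all
        then show ?thesis by (rule LIMSEQ_unique)
      qed (use g h in simp)
    qed
  qed
  from theI'[OF this] show ?thesis
    by (simp add: Gamma_p_def)
qed

lemma Gamma_p_eq_psum:
  assumes "y \<in> Zp" "absv y \<le> r"
  shows "Gamma_p y = G.psum y"
proof -
  obtain f where f: "(\<lambda>k. of_nat (f k)) \<longlonglongrightarrow> y"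
    using Zp_nat_limit[OF assms(1)] .
  have "continuous_on Zp (Gamma_p :: 'a \<Rightarrow> 'a)" "\<And>n. Gamma_p (of_nat n) = gam n"
    using is_Gamma_p_Gamma_p by (auto simp: is_Gamma_p_iff)
  then have lim: "(\<lambda>k. gam (f k)) \<longlonglongrightarrow> Gamma_p y"
    using continuous_Zp_limit[OF _ assms(1) f, of Gamma_p] by simp
  obtain K where K: "K > 0"
    "\<And>x y. absv x \<le> r \<Longrightarrow> absv y \<le> r \<Longrightarrow> absv (G.psum y - G.psum x) \<le> K * absv (y - x)"
    using G.psum_lipschitz by blast
  have diff: "(\<lambda>k. of_nat (f k) - y) \<longlonglongrightarrow> 0"
    using tendsto_diff[OF f tendsto_const[of y]] by simp
  then have absv_diff: "(\<lambda>k. absv (of_nat (f k) - y)) \<longlonglongrightarrow> 0"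
    by (simp only: tendsto_0_absv)
  have "eventually (\<lambda>k. absv (of_nat (f k) - y) < r) sequentially"
    using order_tendstoD(2)[OF absv_diff r_pos] .
  then have le: "eventually (\<lambda>k. absv (gam (f k) - G.psum y) \<le> K * absv (of_nat (f k) - y)) sequentially"
  proof eventually_elim
    case (elim k)
    then have le: "absv (of_nat (f k) :: 'a) \<le> r"
      using absv_add_le[of "of_nat (f k) - y" r y] assms(2) by simp
    then have "gam (f k) = G.psum (of_nat (f k))"
      using absv_of_nat_le_r_iff by (simp add: psum_of_nat)
    then show ?case using K(2)[OF assms(2) le] by simp
  qed
  have null: "(\<lambda>k. K * absv (of_nat (f k) - y)) \<longlonglongrightarrow> 0"
    using tendsto_mult_right_zero[OF absv_diff] .
  have "eventually (\<lambda>k. 0 \<le> absv (gam (f k) - G.psum y)) sequentially"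
    by simp
  then have "(\<lambda>k. absv (gam (f k) - G.psum y)) \<longlonglongrightarrow> 0"
    using le tendsto_const null by (rule tendsto_sandwich)
  then have "(\<lambda>k. gam (f k) - G.psum y) \<longlonglongrightarrow> 0"
    by (simp only: tendsto_0_absv)
  then have "(\<lambda>k. gam (f k)) \<longlonglongrightarrow> G.psum y"
    using tendsto_add[OF _ tendsto_const[of "G.psum y"], of "\<lambda>k. gam (f k) - G.psum y" 0] by simp
  with lim show ?thesis by (rule LIMSEQ_unique)
qed

section \<open>Derivatives on the p-adic integers\<close>

lemma Zp_islimpt:
  assumes "y \<in> (Zp :: 'a set)"
  shows "y islimpt Zp"
  unfolding islimpt_approachable
proof (intro allI impI)
  fix e :: real assume "e > 0"
  then obtain k where "1 / real p ^ k < e"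
    using power_p_small by blast
  moreover have "absv (of_nat (p ^ k) :: 'a) = 1 / real p ^ k"
    by (simp add: absv_power absv_p power_divide)
  moreover have "of_nat (p ^ k) \<noteq> (0::'a)" using p_gt_0 by simp
  ultimately show "\<exists>z\<in>Zp. z \<noteq> y \<and> dist z y < e"
    using Zp_add[OF assms of_nat_in_Zp[of "p ^ k"]]
    by (intro bexI[of _ "y + of_nat (p ^ k)"]) (simp_all add: dist_absv)
qed

lemma Zp_deriv_eqI:
  assumes "y \<in> (Zp :: 'a set)" "has_Zp_deriv h D y"
  shows "Zp_deriv h y = D"
  unfolding Zp_deriv_def
proof (rule the_equality)
  fix D' assume "has_Zp_deriv h D' y"
  moreover have "at y within Zp \<noteq> bot"
    using Zp_islimpt[OF assms(1)] by (simp add: trivial_limit_within)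
  ultimately show "D' = D"
    using assms(2) unfolding has_Zp_deriv_def by (metis tendsto_unique)
qed (fact assms(2))

lemma has_Zp_deriv_psum:
  assumes "nonarch_power_series a r"
    and h: "\<And>z. z \<in> Zp \<Longrightarrow> absv z \<le> r \<Longrightarrow> h z = nonarch_power_series.psum a z"
    and y: "y \<in> (Zp :: 'a set)" "absv y \<le> r"
  shows "has_Zp_deriv h (nonarch_power_series.psum (diffs a) y) y"
proof -
  interpret P: nonarch_power_series a r by fact
  let ?D = "nonarch_power_series.psum (diffs a) y"
  obtain L where L: "L > 0"
    "\<And>x y. absv x \<le> r \<Longrightarrow> absv y \<le> r \<Longrightarrow>
       absv (P.psum y - P.psum x - nonarch_power_series.psum (diffs a) x * (y - x)) \<le> L * absv (y - x) ^ 2"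
    using P.psum_taylor by blast
  show ?thesis
    unfolding has_Zp_deriv_def
  proof (rule tendstoI)
    fix e :: real assume e: "e > 0"
    have cancel: "x - d * u = (x / u - d) * u" if "u \<noteq> 0" for x d u :: 'a
      using that by (simp add: left_diff_distrib)
    have "dist ((h z - h y) / (z - y)) ?D < e"
      if z: "z \<in> Zp" "z \<noteq> y" "dist z y < min r (e / L)" for z
    proof -
      have zy: "absv (z - y) < r" "absv (z - y) < e / L"
        using z(3) by (simp_all add: dist_absv)
      then have "absv z \<le> r"
        using absv_add_le[of "z - y" r y] y(2) by simp
      then have "absv (h z - h y - ?D * (z - y)) \<le> L * absv (z - y) ^ 2"
        using L(2)[OF y(2)] h y z(1) by simp
      moreover have "h z - h y - ?D * (z - y) = ((h z - h y) / (z - y) - ?D) * (z - y)"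
        using z(2) by (intro cancel) simp
      ultimately have "absv ((h z - h y) / (z - y) - ?D) * absv (z - y) \<le> (L * absv (z - y)) * absv (z - y)"
        by (simp only: absv_mult power2_eq_square mult.assoc)
      moreover have "absv (z - y) > 0"
        using z(2) by (simp add: less_le)
      ultimately have "absv ((h z - h y) / (z - y) - ?D) \<le> L * absv (z - y)"
        by (simp only: mult_le_cancel_right_pos)
      also have "\<dots> < e"
        using zy(2) L(1) by (simp add: pos_less_divide_eq mult.commute)
      finally show ?thesis by (simp only: dist_absv)
    qed
    then show "\<forall>\<^sub>F z in at y within Zp. dist ((h z - h y) / (z - y)) ?D < e"
      unfolding eventually_at using e L(1) r_pos by (intro exI[of _ "min r (e / L)"]) auto
  qed
qed

lemma diffs_funpow_power_series: "nonarch_power_series ((diffs ^^ k) g_coeff) r"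
  by (induction k) (auto intro: g_power_series nonarch_power_series.diffs_power_series)

lemma Zp_deriv_funpow_Gamma_p:
  assumes "y \<in> Zp" "absv y \<le> r"
  shows "(Zp_deriv ^^ k) Gamma_p y = nonarch_power_series.psum ((diffs ^^ k) g_coeff) y"
  using assms
proof (induction k arbitrary: y)
  case 0
  then show ?case by (simp add: Gamma_p_eq_psum)
next
  case (Suc k)
  have "has_Zp_deriv ((Zp_deriv ^^ k) Gamma_p) (nonarch_power_series.psum (diffs ((diffs ^^ k) g_coeff)) y) y"
    by (intro has_Zp_deriv_psum diffs_funpow_power_series Suc)
  then show ?case
    using Zp_deriv_eqI[OF Suc.prems(1)] by simp
qed

lemma Gamma_p_differentiable: "Zp_differentiable_times s (Gamma_p :: 'a \<Rightarrow> 'a) 0"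
  unfolding Zp_differentiable_times_def
proof (intro exI[of _ r] conjI allI impI ballI r_pos)
  fix k and y :: 'a assume y: "y \<in> Zp" "dist y 0 < r"
  have "has_Zp_deriv ((Zp_deriv ^^ k) Gamma_p) (nonarch_power_series.psum (diffs ((diffs ^^ k) g_coeff)) y) y"
    using y by (intro has_Zp_deriv_psum diffs_funpow_power_series Zp_deriv_funpow_Gamma_p) (auto simp: dist_absv)
  then show "\<exists>D. has_Zp_deriv ((Zp_deriv ^^ k) Gamma_p) D y" ..
qed

lemma Gamma_p_deriv_0: "(Zp_deriv ^^ s) Gamma_p 0 = fact s * g_coeff s"
proof -
  have "(Zp_deriv ^^ s) Gamma_p 0 = nonarch_power_series.psum ((diffs ^^ s) g_coeff) (0::'a)"
    using of_nat_in_Zp[of 0] r_pos by (intro Zp_deriv_funpow_Gamma_p) auto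
  also have "\<dots> = (diffs ^^ s) g_coeff 0"
    by (rule nonarch_power_series.psum_0[OF diffs_funpow_power_series])
  also have "\<dots> = fact s * g_coeff s"
    using diffs_funpow[of s g_coeff 0] by simp
  finally show ?thesis .
qed

lemma const_term_dwork_exp:
  "const_term_D_inv_x s (dwork_exp p) ((-1) ^ s / fact s * (Zp_deriv ^^ s) (Gamma_p :: 'a \<Rightarrow> 'a) 0)"
proof -
  have "(-1) ^ s / fact s * (Zp_deriv ^^ s) Gamma_p 0 = A s"
    unfolding Gamma_p_deriv_0 g_coeff_def by (simp flip: mult.assoc power_mult_distrib)
  then show ?thesis
    using summand_sums[of s]
    by (simp add: const_term_D_inv_x_def D_inv_x_const_term summand_def[abs_def] B_def)
qed

end

theorem proposition3p1:
  fixes p s :: nat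
  assumes "prime p" and "odd p"
    and "is_Cp p TYPE('a::complete_nonarch_field)"
  shows "Zp_differentiable_times s (Gamma_p :: 'a \<Rightarrow> 'a) 0 \<and>
    const_term_D_inv_x s (dwork_exp p :: 'a fps)
      ((-1) ^ s / fact s * (Zp_deriv ^^ s) Gamma_p 0)"
proof -
  interpret padic p "TYPE('a)"
    using assms by unfold_locales (auto simp: is_Cp_def)
  show ?thesis
    using Gamma_p_differentiable const_term_dwork_exp by blast
qed

end
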